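(* Let $G$ be a group, and let $P$ be the positive cone of a discrete left ordering $<$ of $G$ with least positive element $\epsilon$. If $g\epsilon g^{-1}\in P$ for all $g\in G$, then $P$ is not isolated in $LO(G)$.
   Context: A left ordering of a group $G$ is a strict total ordering $<$ of $G$ such that $g<h$ implies $fg<fh$ for all $f,g,h\in G$. Its positive cone is $P=\{g\in G: g>1\}$. Positive cones are exactly the subsets $P\subset G$ with $PP\subset P$ such that for every $g\in G$ exactly one of $g\in P$, $g^{-1}\in P$, $g=1$ holds; the associated ordering is $g<h$ iff $g^{-1}h\in P$. $LO(G)\subset 2^G$ is the set of all positive cones of $G$, with the subspace topology from the product topology on $2^G$; a subbasis is given by the sets $U_g=\{P\in LO(G): g\in P\}$, $g\in G$. A left ordering is discrete if there is a least element $\epsilon$ among the elements greater than $1$; this $\epsilon$ is called the least positive element.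
   Formalization: The formal theorem additionally assumes that G is not cyclic; the claim as stated fails for G = Z with its usual ordering (ε = 1), since LO(Z) has just two points and is discrete, and no cyclic group satisfies the claim non-vacuously. *)

theory Defs
  imports "HOL-Algebra.Elementary_Groups" "HOL-Analysis.Function_Topology"
begin

(* A relation lt is only constrained on the carrier of G; its values elsewhere are irrelevant. *)
definition left_ordering :: "('a, 'm) monoid_scheme \<Rightarrow> ('a \<Rightarrow> 'a \<Rightarrow> bool) \<Rightarrow> bool"
  where "left_ordering G lt \<longleftrightarrow>
    (\<forall>g\<in>carrier G. \<not> lt g g) \<and>
    (\<forall>f\<in>carrier G. \<forall>g\<in>carrier G. \<forall>h\<in>carrier G. lt f g \<longrightarrow> lt g h \<longrightarrow> lt f h) \<and>
    (\<forall>g\<in>carrier G. \<forall>h\<in>carrier G. g \<noteq> h \<longrightarrow> lt g h \<or> lt h g) \<and>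
    (\<forall>f\<in>carrier G. \<forall>g\<in>carrier G. \<forall>h\<in>carrier G.
        lt g h \<longrightarrow> lt (f \<otimes>\<^bsub>G\<^esub> g) (f \<otimes>\<^bsub>G\<^esub> h))"

definition positive_cone :: "('a, 'm) monoid_scheme \<Rightarrow> ('a \<Rightarrow> 'a \<Rightarrow> bool) \<Rightarrow> 'a set"
  where "positive_cone G lt = {g \<in> carrier G. lt \<one>\<^bsub>G\<^esub> g}"

definition least_positive :: "('a, 'm) monoid_scheme \<Rightarrow> ('a \<Rightarrow> 'a \<Rightarrow> bool) \<Rightarrow> 'a \<Rightarrow> bool"
  where "least_positive G lt e \<longleftrightarrow>
    e \<in> positive_cone G lt \<and> (\<forall>g\<in>positive_cone G lt. g = e \<or> lt e g)"

definition discrete_left_ordering :: "('a, 'm) monoid_scheme \<Rightarrow> ('a \<Rightarrow> 'a \<Rightarrow> bool) \<Rightarrow> bool"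
  where "discrete_left_ordering G lt \<longleftrightarrow> left_ordering G lt \<and> (\<exists>e. least_positive G lt e)"

definition LO :: "('a, 'm) monoid_scheme \<Rightarrow> 'a set set"
  where "LO G = {P. \<exists>lt. left_ordering G lt \<and> P = positive_cone G lt}"

(* The space 2^S, with a subset of S identified with its characteristic function on S;
   the product topology is pulled back along this bijection. *)
definition power_set_topology :: "'a set \<Rightarrow> 'a set topology"
  where "power_set_topology S =
    pullback_topology (Pow S) (\<lambda>A. restrict (\<lambda>x. x \<in> A) S)
      (product_topology (\<lambda>_. discrete_topology (UNIV :: bool set)) S)"

definition LO_topology :: "('a, 'm) monoid_scheme \<Rightarrow> 'a set topology"
  where "LO_topology G = subtopology (power_set_topology (carrier G)) (LO G)"

definition isolated_point :: "'b topology \<Rightarrow> 'b \<Rightarrow> bool"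
  where "isolated_point X x \<longleftrightarrow> x \<in> topspace X \<and> openin X {x}"

lemma topspace_power_set_topology [simp]: "topspace (power_set_topology S) = Pow S"
  by (auto simp: power_set_topology_def topspace_pullback_topology)

lemma LO_subset_Pow: "LO G \<subseteq> Pow (carrier G)"
  by (auto simp: LO_def positive_cone_def)

lemma topspace_LO_topology [simp]: "topspace (LO_topology G) = LO G"
  using LO_subset_Pow[of G] by (auto simp: LO_topology_def)

lemma openin_LO_topology_subbasis:
  assumes "g \<in> carrier G"
  shows "openin (LO_topology G) {P \<in> LO G. g \<in> P}"
proof -
  let ?T = "product_topology (\<lambda>_. discrete_topology (UNIV :: bool set)) (carrier G)"
  let ?U = "{f \<in> topspace ?T. f g \<in> {True}}"
  have "openin ?T ?U"
    by (rule openin_continuous_map_preimage[OF continuous_map_product_projection[OF assms]]) simp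
  moreover have "(\<lambda>A. restrict (\<lambda>x. x \<in> A) (carrier G)) -` ?U \<inter> Pow (carrier G)
      = {A \<in> Pow (carrier G). g \<in> A}"
    using assms by (auto simp: PiE_def extensional_def)
  ultimately have "openin (power_set_topology (carrier G)) {A \<in> Pow (carrier G). g \<in> A}"
    unfolding power_set_topology_def openin_pullback_topology by (intro exI[of _ ?U] conjI) (simp_all only:)
  then have "openin (LO_topology G) ({A \<in> Pow (carrier G). g \<in> A} \<inter> LO G)"
    unfolding LO_topology_def openin_subtopology by blast
  moreover have "{A \<in> Pow (carrier G). g \<in> A} \<inter> LO G = {P \<in> LO G. g \<in> P}"
    using LO_subset_Pow[of G] by auto
  ultimately show ?thesis by simp
qed

(* The infinite cyclic group has exactly two left orderings. Both are discrete and isolated, and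
   conjugation is trivial, so a discrete ordering whose least positive element has only positive
   conjugates need not be non-isolated when the group is cyclic. *)
lemma integer_group_isolated:
  "left_ordering integer_group (<)"
  "least_positive integer_group (<) 1"
  "\<forall>g\<in>carrier integer_group.
     g \<otimes>\<^bsub>integer_group\<^esub> 1 \<otimes>\<^bsub>integer_group\<^esub> inv\<^bsub>integer_group\<^esub> g
       \<in> positive_cone integer_group (<)"
  "isolated_point (LO_topology integer_group) (positive_cone integer_group (<))"
proof -
  show L: "left_ordering integer_group (<)"
    by (auto simp: left_ordering_def)
  show "least_positive integer_group (<) 1"
    by (auto simp: least_positive_def positive_cone_def)
  show "\<forall>g\<in>carrier integer_group.
     g \<otimes>\<^bsub>integer_group\<^esub> 1 \<otimes>\<^bsub>integer_group\<^esub> inv\<^bsub>integer_group\<^esub> g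
       \<in> positive_cone integer_group (<)"
    by (auto simp: positive_cone_def)
  have eq: "P = positive_cone integer_group (<)" if P: "P \<in> LO integer_group" "1 \<in> P" for P
  proof -
    obtain lt where lt: "left_ordering integer_group lt" "P = positive_cone integer_group lt"
      using P(1) unfolding LO_def by blast
    have irr: "\<not> lt g g" and tr: "lt f g \<Longrightarrow> lt g h \<Longrightarrow> lt f h"
      and mono: "lt g h \<Longrightarrow> lt (f + g) (f + h)" for f g h :: int
      using lt(1) unfolding left_ordering_def by auto
    have pos1: "lt 0 1" using P(2) lt(2) by (simp add: positive_cone_def)
    have pos: "lt 0 (1 + int n)" for n
    proof (induction n)
      case (Suc n)
      have "lt 1 (1 + int (Suc n))" using mono[OF Suc, of 1] by simp
      then show ?case by (rule tr[OF pos1])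
    qed (use pos1 in simp)
    have "lt 0 g \<longleftrightarrow> 0 < g" for g
    proof
      assume "0 < g"
      then show "lt 0 g" using pos[of "nat (g - 1)"] by simp
    next
      assume g: "lt 0 g"
      show "0 < g"
      proof (rule ccontr)
        assume "\<not> 0 < g"
        moreover have "g \<noteq> 0" using g irr by auto
        ultimately have "lt 0 (- g)" using pos[of "nat (- g - 1)"] by simp
        then have "lt g 0" using mono[of 0 "- g" g] by simp
        then show False using tr[OF g] irr by blast
      qed
    qed
    then show ?thesis by (simp add: lt(2) positive_cone_def)
  qed
  have mem: "positive_cone integer_group (<) \<in> LO integer_group"
    using L by (auto simp: LO_def)
  have "{P \<in> LO integer_group. 1 \<in> P} = {positive_cone integer_group (<)}"
  proof
    show "{P \<in> LO integer_group. 1 \<in> P} \<subseteq> {positive_cone integer_group (<)}"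
      using eq by blast
    have "1 \<in> positive_cone integer_group (<)" by (simp add: positive_cone_def)
    then show "{positive_cone integer_group (<)} \<subseteq> {P \<in> LO integer_group. 1 \<in> P}"
      using mem by blast
  qed
  with openin_LO_topology_subbasis[of 1 integer_group] mem
  show "isolated_point (LO_topology integer_group) (positive_cone integer_group (<))"
    by (simp add: isolated_point_def)
qed

end

theory Submission
  imports Defs
begin

text \<open>
  Suppose that \<open>P\<close> is isolated. Then a finite set \<open>F \<subseteq> P\<close> determines it: \<open>P\<close> is the only positive cone that
  contains \<open>F\<close>. Let \<open>C\<close> be the cyclic group generated by the least positive element \<open>\<epsilon>\<close>; it is convex.
  As the group is not cyclic, there are positive elements outside \<open>C\<close>, and after adding one
  of them to \<open>F\<close> we may let \<open>m\<close> be the least element of \<open>F - C\<close>.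

  Conjugating \<open>P\<close> by a positive \<open>x \<preceq> m\<close> keeps every \<open>f \<in> F\<close> positive: if \<open>f \<notin> C\<close>, then
  \<open>x \<preceq> f\<close> makes \<open>inv x \<otimes> f \<otimes> x\<close> a product of a nonnegative and a positive element, and if \<open>f \<in> C\<close>, then \<open>f\<close> is
  a positive power of \<open>\<epsilon>\<close>, whose conjugates are positive by hypothesis. Hence all such \<open>x\<close>
  stabilize \<open>P\<close>. It follows that the elements bounded by powers of \<open>m\<close> form a convex subgroup \<open>H\<close>
  (\<open>convex_bounded\<close>) on which the order is invariant on both sides (\<open>bi_ordered_bounded\<close>).
  An order of \<open>H\<close> extends to the whole group by keeping the signs outside \<open>H\<close>
  (\<open>left_cone_replace_on_convex_subgroup\<close>), so it remains to find another order of \<open>H\<close> for which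
  \<open>\<epsilon>\<close> and the elements of \<open>F \<inter> H\<close> are positive.

  The construction behind Hoelder's theorem gives a homomorphism \<open>slope\<close> from \<open>H\<close> to the reals that is
  nonnegative on positive elements and has \<open>slope m = 1\<close>; thus \<open>slope f \<ge> 1\<close> for every \<open>f \<in> (F - C) \<inter> H\<close>.
  There are three cases.

  \<^item> Some positive element outside \<open>C\<close> has slope zero. Then the signs of the elements of slope zero
    outside \<open>C\<close> can be reversed.

  \<^item> Some slope is irrational. Then a functional on the reals that is linear over the rationals
    provides a homomorphism \<open>\<psi>\<close>, not proportional to the slope, and for small \<open>d > 0\<close> the signs of
    \<open>slope + d \<psi>\<close> agree with those of \<open>slope\<close> on \<open>F - C\<close>, but not everywhere.
    The element \<open>\<epsilon>\<close> has slope zero and \<open>\<psi> \<epsilon> = 0\<close>, and ties are broken by the given order.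

  \<^item> All slopes are rational and \<open>C\<close> is the kernel of the slope. Then \<open>H\<close> is abelian of rank two, and the
    coordinate \<open>\<psi>\<close> along \<open>\<epsilon>\<close>, in the rational basis \<open>m, \<epsilon>\<close>, serves the same purpose; here \<open>\<psi> \<epsilon> = 1\<close>, and \<open>m\<close> lies above
    all powers of \<open>\<epsilon>\<close> for the given order, but not for the perturbed one.
\<close>

section \<open>Positive cones and isolated points\<close>

definition left_cone :: "('a, 'm) monoid_scheme \<Rightarrow> 'a set \<Rightarrow> bool"
  where "left_cone G P \<longleftrightarrow>
    P \<subseteq> carrier G \<and> \<one>\<^bsub>G\<^esub> \<notin> P \<and>
    (\<forall>x\<in>P. \<forall>y\<in>P. x \<otimes>\<^bsub>G\<^esub> y \<in> P) \<and>
    (\<forall>x\<in>carrier G. x \<noteq> \<one>\<^bsub>G\<^esub> \<longrightarrow> x \<in> P \<or> inv\<^bsub>G\<^esub> x \<in> P)"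

lemma (in group) inv_mult_cancel [simp]:
  assumes "x \<in> carrier G" "y \<in> carrier G"
  shows "inv x \<otimes> (x \<otimes> y) = y" and "x \<otimes> (inv x \<otimes> y) = y"
  using assms by (simp_all flip: m_assoc)

lemma (in group) int_pow_nat_pow:
  "x \<in> carrier G \<Longrightarrow> (x [^] (p::int)) [^] (k::nat) = x [^] (p * int k)"
  by (metis int_pow_int int_pow_pow)

lemma (in group) int_pow_commute:
  assumes xy: "x \<otimes> y = y \<otimes> x" and [simp]: "x \<in> carrier G" "y \<in> carrier G"
  shows "x [^] (k::int) \<otimes> y = y \<otimes> x [^] k"
proof -
  have nat: "x [^] n \<otimes> y = y \<otimes> x [^] n" for n :: nat
    by (rule group_commutes_pow[OF xy]) auto
  have neg: "inv (x [^] n) \<otimes> y = y \<otimes> inv (x [^] n)" for n :: nat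
  proof -
    have "inv (x [^] n) \<otimes> (y \<otimes> x [^] n) \<otimes> inv (x [^] n) = y \<otimes> inv (x [^] n)"
      by (simp flip: nat)
    then show ?thesis by (simp add: m_assoc)
  qed
  show ?thesis
    using nat neg by (cases k rule: int_cases2) (auto simp: int_pow_neg int_pow_int)
qed

lemma (in group) left_cone_of_ordering:
  assumes "left_ordering G lt"
  shows "left_cone G (positive_cone G lt)"
proof -
  have irr: "\<And>g. g \<in> carrier G \<Longrightarrow> \<not> lt g g"
    and tr: "\<And>f g h. \<lbrakk>f \<in> carrier G; g \<in> carrier G; h \<in> carrier G; lt f g; lt g h\<rbrakk> \<Longrightarrow> lt f h"
    and tot: "\<And>g h. \<lbrakk>g \<in> carrier G; h \<in> carrier G; g \<noteq> h\<rbrakk> \<Longrightarrow> lt g h \<or> lt h g"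
    and mono: "\<And>f g h. \<lbrakk>f \<in> carrier G; g \<in> carrier G; h \<in> carrier G; lt g h\<rbrakk>
        \<Longrightarrow> lt (f \<otimes> g) (f \<otimes> h)"
    using assms unfolding left_ordering_def by blast+
  have "lt \<one> (x \<otimes> y)" if "x \<in> carrier G" "y \<in> carrier G" "lt \<one> x" "lt \<one> y" for x y
    using mono[of x \<one> y] tr[of \<one> x "x \<otimes> y"] that by simp
  moreover have "lt \<one> x \<or> lt \<one> (inv x)" if "x \<in> carrier G" "x \<noteq> \<one>" for x
    using tot[of \<one> x] mono[of "inv x" x \<one>] that by auto
  ultimately show ?thesis
    using irr by (auto simp: left_cone_def positive_cone_def)
qed

lemma (in group) mem_LO_iff: "P \<in> LO G \<longleftrightarrow> left_cone G P"
proof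
  assume "P \<in> LO G"
  then show "left_cone G P" using left_cone_of_ordering by (auto simp: LO_def)
next
  assume P: "left_cone G P"
  define lt where "lt x y \<longleftrightarrow> inv x \<otimes> y \<in> P" for x y
  have mult: "x \<otimes> y \<in> P" if "x \<in> P" "y \<in> P" for x y
    using P that by (auto simp: left_cone_def)
  have "left_ordering G lt"
    unfolding left_ordering_def
  proof (intro conjI ballI impI)
    show "\<not> lt g g" if "g \<in> carrier G" for g
      using P that by (simp add: lt_def left_cone_def)
    show "lt f h" if "f \<in> carrier G" "g \<in> carrier G" "h \<in> carrier G" "lt f g" "lt g h" for f g h
      using mult[of "inv f \<otimes> g" "inv g \<otimes> h"] that by (simp add: lt_def m_assoc)
    show "lt g h \<or> lt h g" if gh: "g \<in> carrier G" "h \<in> carrier G" "g \<noteq> h" for g h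
    proof -
      have "inv g \<otimes> h \<noteq> \<one>" using gh by (metis inv_equality inv_inv inv_closed)
      moreover have "inv (inv g \<otimes> h) = inv h \<otimes> g" using gh by (simp add: inv_mult_group)
      ultimately show ?thesis
        using P gh unfolding lt_def left_cone_def by (metis inv_closed m_closed)
    qed
    show "lt (f \<otimes> g) (f \<otimes> h)"
      if "f \<in> carrier G" "g \<in> carrier G" "h \<in> carrier G" "lt g h" for f g h
      using that by (simp add: lt_def inv_mult_group m_assoc)
  qed
  moreover have "P = positive_cone G lt"
    using P by (auto simp: positive_cone_def lt_def left_cone_def)
  ultimately show "P \<in> LO G" by (auto simp: LO_def)
qed

text \<open>
  A basic open set prescribes membership for finitely many elements. Prescribing that \<open>g\<close> is not in the
  cone amounts, for \<open>g \<noteq> \<one>\<close>, to prescribing that its inverse is, so that a finite set of positive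
  elements suffices.
\<close>

lemma (in group) isolated_point_LO_finite_witness:
  assumes "isolated_point (LO_topology G) P"
  shows "\<exists>F. finite F \<and> F \<subseteq> P \<and> (\<forall>Q. left_cone G Q \<and> F \<subseteq> Q \<longrightarrow> Q = P)"
proof -
  let ?chi = "\<lambda>A. restrict (\<lambda>x. x \<in> A) (carrier G)"
  let ?T = "product_topology (\<lambda>_. discrete_topology (UNIV :: bool set)) (carrier G)"
  have P: "left_cone G P" and op: "openin (LO_topology G) {P}"
    using assms by (auto simp: isolated_point_def mem_LO_iff)
  have Pc: "P \<subseteq> carrier G" using P by (simp add: left_cone_def)
  obtain U where U: "openin ?T U" and PU: "{P} = (?chi -` U \<inter> Pow (carrier G)) \<inter> LO G"
    using op unfolding LO_topology_def openin_subtopology power_set_topology_def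
      openin_pullback_topology by blast
  then have "?chi P \<in> U" by blast
  then obtain W where fin: "finite {i \<in> carrier G. W i \<noteq> UNIV}"
    and W: "?chi P \<in> Pi\<^sub>E (carrier G) W" "Pi\<^sub>E (carrier G) W \<subseteq> U"
    using U unfolding openin_product_topology_alt by force
  \<comment> \<open>The finite set \<open>?A\<close> of coordinates that the basic neighbourhood constrains.\<close>
  let ?A = "{i \<in> carrier G. W i \<noteq> UNIV}"
  let ?F = "(?A \<union> m_inv G ` ?A) \<inter> P"
  have "Q = P" if Q: "left_cone G Q" "?F \<subseteq> Q" for Q
  proof -
    have agree: "i \<in> Q \<longleftrightarrow> i \<in> P" if i: "i \<in> ?A" for i
    proof (cases "i \<in> P")
      case True
      then show ?thesis using Q i by auto
    next
      case False
      have "i \<notin> Q"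
      proof
        assume iQ: "i \<in> Q"
        then have "i \<noteq> \<one>" using Q(1) by (auto simp: left_cone_def)
        then have "inv i \<in> P" using False P i by (auto simp: left_cone_def)
        then have "inv i \<in> Q" using Q(2) i by blast
        then have "i \<otimes> inv i \<in> Q" using iQ Q(1) by (auto simp: left_cone_def)
        then show False using Q(1) i by (auto simp: left_cone_def)
      qed
      then show ?thesis using False by simp
    qed
    have "?chi Q \<in> Pi\<^sub>E (carrier G) W"
    proof (rule PiE_I)
      fix i assume i: "i \<in> carrier G"
      then have "(i \<in> P) \<in> W i" using PiE_mem[OF W(1) i] by simp
      then show "?chi Q i \<in> W i" using agree[of i] i by (cases "W i = UNIV") auto
    qed simp
    then have "?chi Q \<in> U" using W(2) by blast
    moreover have "Q \<subseteq> carrier G" "Q \<in> LO G"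
      using Q(1) by (auto simp: left_cone_def mem_LO_iff)
    ultimately have "Q \<in> {P}" unfolding PU by blast
    then show ?thesis by simp
  qed
  then show ?thesis using fin by (intro exI[of _ ?F]) auto
qed

section \<open>Left-ordered groups and convex subgroups\<close>

locale left_ordered_group = group G for G (structure) +
  fixes P :: "'a set"
  assumes left_cone: "left_cone G P"
begin

lemma P_subset: "P \<subseteq> carrier G"
  and one_notin_P [simp]: "\<one> \<notin> P"
  and P_mult [intro]: "x \<in> P \<Longrightarrow> y \<in> P \<Longrightarrow> x \<otimes> y \<in> P"
  and P_total: "x \<in> carrier G \<Longrightarrow> x \<noteq> \<one> \<Longrightarrow> x \<in> P \<or> inv x \<in> P"
  using left_cone by (auto simp: left_cone_def)

lemma P_carrier [simp]: "x \<in> P \<Longrightarrow> x \<in> carrier G"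
  using P_subset by blast

lemma P_inv: "x \<in> P \<Longrightarrow> inv x \<notin> P"
  using P_mult[of x "inv x"] by auto

lemma P_nat_pow:
  assumes "x \<in> P" "0 < n"
  shows "x [^] (n::nat) \<in> P"
  using assms(2) by (induction n rule: nat_induct_non_zero) (use assms(1) in auto)

definition le (infix "\<preceq>" 50) where "x \<preceq> y \<longleftrightarrow> x = y \<or> inv x \<otimes> y \<in> P"

lemma le_refl [simp]: "x \<preceq> x"
  by (simp add: le_def)

lemma le_trans [trans]:
  assumes "x \<preceq> y" "y \<preceq> z" "x \<in> carrier G" "y \<in> carrier G" "z \<in> carrier G"
  shows "x \<preceq> z"
  using assms P_mult[of "inv x \<otimes> y" "inv y \<otimes> z"] by (auto simp: le_def m_assoc)

lemma le_antisym:
  assumes "x \<preceq> y" "y \<preceq> x" "x \<in> carrier G" "y \<in> carrier G"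
  shows "x = y"
  using assms P_inv[of "inv x \<otimes> y"] by (auto simp: le_def inv_mult_group)

lemma le_linear:
  assumes "x \<in> carrier G" "y \<in> carrier G"
  shows "x \<preceq> y \<or> y \<preceq> x"
proof -
  have "inv x \<otimes> y = \<one> \<Longrightarrow> x = y" using assms by (metis inv_equality inv_inv inv_closed)
  then show ?thesis
    using P_total[of "inv x \<otimes> y"] assms by (auto simp: le_def inv_mult_group)
qed

lemma le_mult_left:
  assumes "x \<preceq> y" "x \<in> carrier G" "y \<in> carrier G" "z \<in> carrier G"
  shows "z \<otimes> x \<preceq> z \<otimes> y"
  using assms by (auto simp: le_def inv_mult_group m_assoc)

lemma least_exists:
  assumes "finite A" "A \<noteq> {}" "A \<subseteq> carrier G"
  shows "\<exists>a\<in>A. \<forall>b\<in>A. a \<preceq> b"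
  using assms
proof (induction A rule: finite_ne_induct)
  case (insert x A)
  then obtain a where a: "a \<in> A" "\<forall>b\<in>A. a \<preceq> b" by auto
  show ?case
  proof (cases "x \<preceq> a")
    case True
    then have "x \<preceq> b" if "b \<in> A" for b
      using le_trans[of x a b] a that insert.prems by auto
    then show ?thesis by auto
  next
    case False
    then have "a \<preceq> x" using le_linear[of a x] a insert.prems by auto
    then show ?thesis using a by auto
  qed
qed auto

text \<open>
  For a subgroup \<open>K\<close>, multiplication on the left by elements of \<open>K\<close> preserves the sign of elements outside \<open>K\<close> if
  and only if \<open>K\<close> is convex. This form speaks of the cone only, and it is the one in which convexity
  is used.
\<close>

definition convex_subgroup :: "'a set \<Rightarrow> bool"
  where "convex_subgroup K \<longleftrightarrow> subgroup K G \<and> (\<forall>k\<in>K. \<forall>g\<in>P - K. k \<otimes> g \<in> P)"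

text \<open>
  If \<open>g \<otimes> k\<close> were negative, its inverse would be a positive element outside \<open>K\<close>, and multiplying that
  by \<open>k\<close> on the left would give \<open>inv g\<close> a positive sign.
\<close>

lemma convex_subgroup_mult_right:
  assumes K: "convex_subgroup K" and "k \<in> K" "g \<in> P - K"
  shows "g \<otimes> k \<in> P"
proof (rule ccontr)
  interpret K: subgroup K G using K by (simp add: convex_subgroup_def)
  assume "g \<otimes> k \<notin> P"
  moreover have "g \<otimes> k \<notin> K"
    using assms K.m_closed[of "g \<otimes> k" "inv k"] by (auto simp: m_assoc)
  moreover from this have "g \<otimes> k \<noteq> \<one>" using K.one_closed by auto
  ultimately have "inv (g \<otimes> k) \<in> P - K"
    using P_total[of "g \<otimes> k"] assms K.m_inv_closed[of "inv (g \<otimes> k)"] by auto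
  then have "k \<otimes> inv (g \<otimes> k) \<in> P"
    using K assms by (auto simp: convex_subgroup_def)
  then show False using P_inv[of g] assms by (simp add: inv_mult_group)
qed

text \<open>
  The sign of an element outside \<open>K\<close> does not change under multiplication by \<open>K\<close> on either side, so
  the signs inside \<open>K\<close> can be chosen independently of those outside.
\<close>

lemma left_cone_replace_on_convex_subgroup:
  assumes K: "convex_subgroup K" and R: "left_cone (G\<lparr>carrier := K\<rparr>) R"
  shows "left_cone G ((P - K) \<union> R)"
proof -
  interpret K: subgroup K G using K by (simp add: convex_subgroup_def)
  have sub: "subgroup K G" ..
  have RK: "R \<subseteq> K" using R by (simp add: left_cone_def)
  have notK: "x \<otimes> y \<notin> K" if "x \<in> P - K" "y \<in> P - K" for x y
  proof
    assume *: "x \<otimes> y \<in> K"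
    then have "inv (x \<otimes> y) \<otimes> x \<in> P" 
      using K that by (auto simp: convex_subgroup_def)
    then show False using P_inv[of y] that by (simp add: inv_mult_group m_assoc)
  qed
  have notK1: "k \<otimes> x \<notin> K" if "x \<in> P - K" "k \<in> K" for x k
    using that K.m_closed[of "inv k" "k \<otimes> x"] by auto
  have notK2: "x \<otimes> k \<notin> K" if "x \<in> P - K" "k \<in> K" for x k
    using that K.m_closed[of "x \<otimes> k" "inv k"] by (auto simp: m_assoc)
  have mult: "x \<otimes> y \<in> (P - K) \<union> R" if "x \<in> (P - K) \<union> R" "y \<in> (P - K) \<union> R" for x y
    using that RK R notK[of x y] notK1[of y x] notK2[of x y] convex_subgroup_mult_right[OF K, of y x] K
    unfolding convex_subgroup_def left_cone_def by auto
  have "x \<in> (P - K) \<union> R \<or> inv x \<in> (P - K) \<union> R" if x: "x \<in> carrier G" "x \<noteq> \<one>" for x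
  proof (cases "x \<in> K")
    case True
    then show ?thesis using R x sub by (auto simp: left_cone_def m_inv_consistent)
  next
    case False
    then have "inv x \<notin> K" using K.m_inv_closed[of "inv x"] x by auto
    then show ?thesis using P_total[OF x] False by auto
  qed
  then show ?thesis
    using mult RK R K.subset unfolding left_cone_def by auto
qed

text \<open>
  A homomorphism to the reals decides the sign, and the given order breaks ties on its kernel.
\<close>

lemma left_cone_lex:
  fixes \<theta> :: "'a \<Rightarrow> real"
  assumes hom: "\<And>x y. x \<in> carrier G \<Longrightarrow> y \<in> carrier G \<Longrightarrow> \<theta> (x \<otimes> y) = \<theta> x + \<theta> y"
  shows "left_cone G {x \<in> carrier G. \<theta> x > 0 \<or> \<theta> x = 0 \<and> x \<in> P}"
proof -
  have one: "\<theta> \<one> = 0" using hom[of \<one> \<one>] by simp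
  have inv: "\<theta> (inv x) = - \<theta> x" if "x \<in> carrier G" for x
    using hom[of x "inv x"] one that by simp
  show ?thesis
    unfolding left_cone_def
    using P_total by (auto simp: hom inv one)
qed


lemma left_cone_inverses: "left_cone G {x \<in> carrier G. inv x \<in> P}"
  using P_total by (auto simp: left_cone_def inv_mult_group)

text \<open>
  The opposite order has the same convex subgroups, so its signs on \<open>K\<close> can be replaced by the
  original ones.
\<close>

lemma left_cone_flip_above_convex_subgroup:
  assumes K: "convex_subgroup K"
  shows "left_cone G ({x \<in> carrier G. inv x \<in> P - K} \<union> (P \<inter> K))"
proof -
  interpret K: subgroup K G using K by (simp add: convex_subgroup_def)
  have sub: "subgroup K G" ..
  have inK: "inv x \<in> K \<longleftrightarrow> x \<in> K" if "x \<in> carrier G" for x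
    using K.m_inv_closed that by (metis inv_inv)
  have cone: "left_cone (G\<lparr>carrier := K\<rparr>) (P \<inter> K)"
    using P_total by (auto simp: left_cone_def m_inv_consistent[OF sub])
  define N where "N = {x \<in> carrier G. inv x \<in> P}"
  have right: "k \<otimes> g \<in> N" if kg: "k \<in> K" "g \<in> N - K" for k g
  proof -
    have "inv g \<otimes> inv k \<in> P"
      using convex_subgroup_mult_right[OF K, of "inv k" "inv g"] kg by (auto simp: N_def inK)
    then show ?thesis using kg by (simp add: N_def inv_mult_group)
  qed
  have N_eq: "N - K = {x \<in> carrier G. inv x \<in> P - K}" by (auto simp: N_def inK)
  interpret N: left_ordered_group G N
    by unfold_locales (simp add: N_def left_cone_inverses)
  have "N.convex_subgroup K"
    using right sub by (simp add: N.convex_subgroup_def)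
  then have "left_cone G ((N - K) \<union> (P \<inter> K))"
    using cone by (rule N.left_cone_replace_on_convex_subgroup)
  then show ?thesis by (simp add: N_eq)
qed

text \<open>
  No element lies strictly between \<open>\<one>\<close> and \<open>e\<close>; therefore a positive element outside the group
  of powers of \<open>e\<close> stays positive, and outside, when it is multiplied by \<open>inv e\<close>.
\<close>

lemma convex_subgroup_least_powers:
  assumes e: "e \<in> P" and least: "\<And>x. x \<in> P \<Longrightarrow> e \<preceq> x"
  shows "convex_subgroup (range (\<lambda>k::int. e [^] k))" (is "convex_subgroup ?C")
proof -
  have sub: "subgroup ?C G"
  proof (rule subgroupI)
    show "inv a \<in> ?C" if "a \<in> ?C" for a
      using that e by (auto simp flip: int_pow_neg)
    show "a \<otimes> b \<in> ?C" if "a \<in> ?C" "b \<in> ?C" for a b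
      using that e by (auto simp flip: int_pow_mult)
  qed (use e in auto)
  then interpret C: subgroup ?C G .
  have eC: "e \<in> ?C" using e by (auto intro: range_eqI[of _ _ 1])
  have step: "inv e \<otimes> g \<in> P - ?C" if g: "g \<in> P - ?C" for g
  proof -
    have "g \<noteq> e" using g eC by auto
    then have "inv e \<otimes> g \<in> P" using least[of g] g by (auto simp: le_def)
    moreover have "inv e \<otimes> g \<notin> ?C"
      using C.m_closed[OF eC, of "inv e \<otimes> g"] g e by auto
    ultimately show ?thesis by simp
  qed
  have down: "inv (e [^] n) \<otimes> g \<in> P - ?C" if g: "g \<in> P - ?C" for g and n :: nat
  proof (induction n)
    case (Suc n)
    then show ?case using step[OF Suc] g e by (simp add: inv_mult_group m_assoc)
  qed (use g in simp)
  have "e [^] k \<otimes> g \<in> P" if g: "g \<in> P - ?C" for g and k :: int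
  proof (cases "0 < k")
    case True
    then have "e [^] k = e [^] nat k" by (simp flip: int_pow_int)
    moreover have "e [^] nat k \<in> P" using P_nat_pow[OF e, of "nat k"] True by simp
    ultimately show ?thesis using g by auto
  next
    case False
    then have "e [^] k = inv (e [^] nat (- k))"
      using e by (simp flip: int_pow_int int_pow_neg)
    then show ?thesis using down[OF g, of "nat (- k)"] by simp
  qed
  then show ?thesis using sub by (auto simp: convex_subgroup_def)
qed

end

section \<open>Bi-ordered groups\<close>

locale bi_ordered_group = left_ordered_group +
  assumes P_conj: "\<lbrakk>x \<in> P; g \<in> carrier G\<rbrakk> \<Longrightarrow> inv g \<otimes> x \<otimes> g \<in> P"
begin

lemma le_mult_right:
  assumes "x \<preceq> y" "x \<in> carrier G" "y \<in> carrier G" "z \<in> carrier G"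
  shows "x \<otimes> z \<preceq> y \<otimes> z"
  using assms P_conj[of "inv x \<otimes> y" z] by (auto simp: le_def inv_mult_group m_assoc)

lemma le_mult:
  assumes "x \<preceq> y" "u \<preceq> v" "x \<in> carrier G" "y \<in> carrier G" "u \<in> carrier G" "v \<in> carrier G"
  shows "x \<otimes> u \<preceq> y \<otimes> v"
  using le_trans[OF le_mult_right[of x y u] le_mult_left[of u v y]] assms by simp

lemma le_nat_pow:
  assumes "x \<preceq> y" "x \<in> carrier G" "y \<in> carrier G"
  shows "x [^] (n::nat) \<preceq> y [^] n"
  by (induction n) (use assms in \<open>auto intro!: le_mult\<close>)

text \<open>
  Roots are unique because \<open>u\<close> strictly below \<open>v\<close> forces every power of \<open>u\<close> strictly below that of \<open>v\<close>.
\<close>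

lemma nat_pow_inj:
  assumes "x [^] n = y [^] n" "0 < (n::nat)" "x \<in> carrier G" "y \<in> carrier G"
  shows "x = y"
proof -
  have less: "u [^] n \<noteq> v [^] n" if uv: "inv u \<otimes> v \<in> P" "u \<in> carrier G" "v \<in> carrier G" for u v
  proof -
    have "inv (u [^] n) \<otimes> v [^] n \<in> P"
      using \<open>0 < n\<close>
    proof (induction n rule: nat_induct_non_zero)
      case (Suc n)
      have "inv (u [^] Suc n) \<otimes> v [^] Suc n
          = (inv u \<otimes> (inv (u [^] n) \<otimes> v [^] n) \<otimes> u) \<otimes> (inv u \<otimes> v)"
        using uv by (simp add: inv_mult_group m_assoc)
      then show ?case using P_mult[OF P_conj[OF Suc(2) uv(2)] uv(1)] by simp
    qed (use uv in simp)
    then show ?thesis using uv by auto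
  qed
  show ?thesis
    using less[of x y] less[of y x] le_linear[of x y] assms by (auto simp: le_def)
qed

text \<open>
  Conjugation by \<open>y\<close> fixes the power of \<open>x\<close>, hence it fixes the unique root \<open>x\<close>.
\<close>

lemma commute_of_nat_pow_commute:
  assumes "x [^] n \<otimes> y = y \<otimes> x [^] n" "0 < (n::nat)" "x \<in> carrier G" "y \<in> carrier G"
  shows "x \<otimes> y = y \<otimes> x"
proof -
  have "(inv y \<otimes> x \<otimes> y) [^] k = inv y \<otimes> x [^] k \<otimes> y" for k :: nat
    by (induction k) (use assms(3,4) in \<open>auto simp: m_assoc\<close>)
  then have "(inv y \<otimes> x \<otimes> y) [^] n = x [^] n"
    using assms by (simp add: m_assoc)
  then have "inv y \<otimes> x \<otimes> y = x"
    by (rule nat_pow_inj) (use assms in simp_all)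
  then have "y \<otimes> (inv y \<otimes> (x \<otimes> y)) = y \<otimes> x" using assms by (simp add: m_assoc)
  then show ?thesis using assms by simp
qed

text \<open>
  Sorting the letters of a word in \<open>x\<close> and \<open>y\<close> by adjacent swaps moves the word in one direction
  of the order only. This replaces commutativity in the proof that slopes are additive.
\<close>

lemma pow_mult_between:
  assumes "y \<otimes> x \<preceq> x \<otimes> y" and [simp]: "x \<in> carrier G" "y \<in> carrier G"
  shows "y [^] n \<otimes> x [^] n \<preceq> (y \<otimes> x) [^] n"
    and "(y \<otimes> x) [^] n \<preceq> (x \<otimes> y) [^] n"
    and "(x \<otimes> y) [^] n \<preceq> x [^] n \<otimes> y [^] (n::nat)"
proof -
  \<comment> \<open>Moving a letter \<open>y\<close> to the right, past letters \<open>x\<close>, increases the word.\<close>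
  have swap: "y \<otimes> x [^] k \<preceq> x [^] k \<otimes> y" for k :: nat
  proof (induction k)
    case (Suc k)
    have "y \<otimes> x [^] k \<otimes> x \<preceq> x [^] k \<otimes> y \<otimes> x" by (rule le_mult_right[OF Suc]) auto
    also have "x [^] k \<otimes> y \<otimes> x \<preceq> x [^] k \<otimes> (x \<otimes> y)"
      using le_mult_left[OF assms(1), of "x [^] k"] by (simp add: m_assoc)
    finally show ?case by (simp add: m_assoc)
  qed simp
  have swap': "y [^] k \<otimes> x \<preceq> x \<otimes> y [^] k" for k :: nat
  proof (induction k)
    case (Suc k)
    have "y [^] k \<otimes> (y \<otimes> x) \<preceq> y [^] k \<otimes> (x \<otimes> y)" by (rule le_mult_left[OF assms(1)]) auto
    also have "y [^] k \<otimes> (x \<otimes> y) \<preceq> x \<otimes> y [^] k \<otimes> y"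
      using le_mult_right[OF Suc, of y] by (simp add: m_assoc)
    finally show ?case by (simp add: m_assoc)
  qed simp
  show "y [^] n \<otimes> x [^] n \<preceq> (y \<otimes> x) [^] n"
  proof (induction n)
    case (Suc n)
    have "y [^] n \<otimes> (y \<otimes> x [^] n) \<otimes> x \<preceq> y [^] n \<otimes> (x [^] n \<otimes> y) \<otimes> x"
      by (intro le_mult_right le_mult_left swap) auto
    also have "y [^] n \<otimes> (x [^] n \<otimes> y) \<otimes> x \<preceq> (y \<otimes> x) [^] n \<otimes> (y \<otimes> x)"
      using le_mult_right[OF Suc, of "y \<otimes> x"] by (simp add: m_assoc)
    finally show ?case by (simp add: m_assoc)
  qed simp
  show "(x \<otimes> y) [^] n \<preceq> x [^] n \<otimes> y [^] n"
  proof (induction n)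
    case (Suc n)
    have "(x \<otimes> y) [^] n \<otimes> (x \<otimes> y) \<preceq> x [^] n \<otimes> y [^] n \<otimes> (x \<otimes> y)"
      by (rule le_mult_right[OF Suc]) auto
    also have "x [^] n \<otimes> y [^] n \<otimes> (x \<otimes> y) = x [^] n \<otimes> (y [^] n \<otimes> x) \<otimes> y"
      by (simp add: m_assoc)
    also have "\<dots> \<preceq> x [^] n \<otimes> (x \<otimes> y [^] n) \<otimes> y"
      by (intro le_mult_right le_mult_left swap') auto
    finally show ?case by (simp add: m_assoc)
  qed simp
  show "(y \<otimes> x) [^] n \<preceq> (x \<otimes> y) [^] n"
    by (rule le_nat_pow[OF assms(1)]) auto
qed

end

section \<open>The slope homomorphism\<close>

text \<open>
  With \<open>m\<close> as unit of length every element can be measured, because powers of \<open>m\<close> eventually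
  exceed it. The group need not be archimedean: elements that are infinitesimal with respect to \<open>m\<close>
  get length zero.
\<close>

locale bi_ordered_group_cofinal = bi_ordered_group +
  fixes m
  assumes m_pos: "m \<in> P"
    and cofinal: "x \<in> carrier G \<Longrightarrow> \<exists>k::nat. x \<preceq> m [^] k"
begin

lemma m_carrier [simp]: "m \<in> carrier G"
  using m_pos by simp

lemma m_pow_le_iff: "m [^] (p::int) \<preceq> m [^] q \<longleftrightarrow> p \<le> q"
proof -
  have diff: "inv (m [^] p) \<otimes> m [^] q \<in> P" if "p < q" for p q :: int
  proof -
    have "inv (m [^] p) \<otimes> m [^] q = m [^] nat (q - p)"
      using that by (simp flip: int_pow_int int_pow_neg int_pow_mult)
    then show ?thesis using P_nat_pow[OF m_pos, of "nat (q - p)"] that by simp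
  qed
  then have *: "m [^] p \<preceq> m [^] q" if "p \<le> q" for p q :: int
    using that by (cases "p = q") (auto simp: le_def)
  have "\<not> m [^] p \<preceq> m [^] q" if "q < p"
  proof
    assume "m [^] p \<preceq> m [^] q"
    then have "m [^] p = m [^] q"
      using le_antisym[OF _ *[of q p]] that by simp
    then show False using diff[OF that] by simp
  qed
  then show ?thesis using *[of p q] by (meson not_le)
qed

lemma floor_exists:
  assumes x: "x \<in> carrier G"
  shows "\<exists>p::int. m [^] p \<preceq> x \<and> x \<preceq> m [^] (p + 1)"
proof -
  obtain k l :: nat where k: "x \<preceq> m [^] k" and l: "inv x \<preceq> m [^] l"
    using cofinal x by (meson inv_closed)
  have "m [^] (- int l) \<preceq> x"
    using le_mult_right[OF le_mult_left[OF l, of "inv (m [^] l)"], of x] x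
    by (simp add: m_assoc int_pow_neg int_pow_int)
  then have "\<not> (x \<preceq> m [^] (int 0 - int l)) \<or> x = m [^] (- int l)"
    using le_antisym[of x "m [^] (- int l)"] x by auto
  then show ?thesis
  proof
    assume 0: "\<not> (x \<preceq> m [^] (int 0 - int l))"
    obtain n where n: "\<forall>i<n. \<not> (x \<preceq> m [^] (int i - int l))" "x \<preceq> m [^] (int n - int l)"
      using k ex_least_nat_le[of "\<lambda>i. x \<preceq> m [^] (int i - int l)" "k + l"]
      by (auto simp: int_pow_int)
    then obtain i where i: "n = Suc i" using 0 by (cases n) auto
    then have "m [^] (int i - int l) \<preceq> x"
      using n le_linear[of x "m [^] (int i - int l)"] x by auto
    moreover have "int n - int l = int i - int l + 1" using i by simp
    ultimately show ?thesis using n(2) by metis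
  next
    assume "x = m [^] (- int l)"
    then show ?thesis using m_pow_le_iff by (intro exI[of _ "- int l"]) simp
  qed
qed

text \<open>
  This is the real number at the Dedekind cut that compares powers of the element with powers of \<open>m\<close>.
\<close>

definition slope :: "'a \<Rightarrow> real"
  where "slope x = Sup {real_of_int p / real n | p n. 0 < n \<and> m [^] p \<preceq> x [^] n}"

lemma slope_bounds:
  assumes x: "x \<in> carrier G" and n: "0 < (n::nat)"
  shows "m [^] (p::int) \<preceq> x [^] n \<Longrightarrow> real_of_int p \<le> real n * slope x"
    and "x [^] n \<preceq> m [^] (q::int) \<Longrightarrow> real n * slope x \<le> real_of_int q"
proof -
  let ?S = "{real_of_int p / real n | p n. 0 < n \<and> m [^] p \<preceq> x [^] n}"
  have compare: "real_of_int p / real k \<le> real_of_int q / real l"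
    if "0 < k" "0 < l" "m [^] p \<preceq> x [^] k" "x [^] l \<preceq> m [^] q" for p q :: int and k l :: nat
  proof -
    have "(m [^] p) [^] l \<preceq> (x [^] k) [^] l" using that x by (intro le_nat_pow) auto
    also have "(x [^] k) [^] l = (x [^] l) [^] k" using x by (simp add: nat_pow_pow mult.commute)
    also have "\<dots> \<preceq> (m [^] q) [^] k" using that x by (intro le_nat_pow) auto
    finally have "p * int l \<le> q * int k" using x by (simp add: int_pow_nat_pow m_pow_le_iff)
    then have "real_of_int p * real l \<le> real_of_int q * real k"
      by (metis of_int_le_iff of_int_mult of_int_of_nat_eq)
    then show ?thesis using that by (simp add: field_simps)
  qed
  obtain a :: int where a: "m [^] a \<preceq> x [^] (1::nat)" "x [^] (1::nat) \<preceq> m [^] (a + 1)"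
    using floor_exists[OF x] x by auto
  have bdd: "bdd_above ?S"
  proof (rule bdd_aboveI)
    fix t assume "t \<in> ?S"
    then obtain p n where t: "t = real_of_int p / real n" and n: "0 < n" and p: "m [^] p \<preceq> x [^] n"
      by blast
    show "t \<le> real_of_int (a + 1) / real 1"
      unfolding t by (rule compare[OF n zero_less_one p a(2)])
  qed
  have ne: "?S \<noteq> {}" using a(1) by (auto intro!: exI[of _ a] exI[of _ "1::nat"])
  show "real_of_int p \<le> real n * slope x" if "m [^] p \<preceq> x [^] n"
  proof -
    have "real_of_int p / real n \<le> slope x"
      unfolding slope_def by (rule cSup_upper[OF _ bdd]) (use that n in auto)
    then show ?thesis using n by (simp add: field_simps)
  qed
  show "real n * slope x \<le> real_of_int q" if "x [^] n \<preceq> m [^] q"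
  proof -
    have "slope x \<le> real_of_int q / real n"
      unfolding slope_def 
    proof (rule cSup_least[OF ne])
      fix t assume "t \<in> ?S"
      then obtain p k where t: "t = real_of_int p / real k" and k: "0 < k" and p: "m [^] p \<preceq> x [^] k"
        by blast
      show "t \<le> real_of_int q / real n"
        unfolding t by (rule compare[OF k n p that])
    qed
    then show ?thesis using n by (simp add: field_simps)
  qed
qed

text \<open>
  Enclose the \<open>n\<close>-th powers of \<open>x\<close> and \<open>y\<close> between consecutive powers of \<open>m\<close>. The \<open>n\<close>-th power of \<open>x \<otimes> y\<close>
  lies between the two products of these powers, so additivity of the slope fails by at most \<open>2 / n\<close>,
  for every \<open>n\<close>.
\<close>

lemma slope_mult:
  assumes x [simp]: "x \<in> carrier G" and y [simp]: "y \<in> carrier G"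
  shows "slope (x \<otimes> y) = slope x + slope y"
proof -
  have bound: "real n * \<bar>slope (x \<otimes> y) - (slope x + slope y)\<bar> \<le> 2" if n: "0 < n" for n :: nat
  proof -
    obtain a :: int where a: "m [^] a \<preceq> x [^] n" "x [^] n \<preceq> m [^] (a + 1)"
      using floor_exists[of "x [^] n"] by auto
    obtain b :: int where b: "m [^] b \<preceq> y [^] n" "y [^] n \<preceq> m [^] (b + 1)"
      using floor_exists[of "y [^] n"] by auto
    have ab: "m [^] (a + b) \<preceq> x [^] n \<otimes> y [^] n" "m [^] (a + b) \<preceq> y [^] n \<otimes> x [^] n"
      using le_mult[OF a(1) b(1)] le_mult[OF b(1) a(1)]
      by (simp_all add: add.commute flip: int_pow_mult)
    have ab': "x [^] n \<otimes> y [^] n \<preceq> m [^] (a + b + 2)" "y [^] n \<otimes> x [^] n \<preceq> m [^] (a + b + 2)"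
      using le_mult[OF a(2) b(2)] le_mult[OF b(2) a(2)]
      by (simp_all add: algebra_simps flip: int_pow_mult)
    have "m [^] (a + b) \<preceq> (x \<otimes> y) [^] n \<and> (x \<otimes> y) [^] n \<preceq> m [^] (a + b + 2)"
    proof (cases "y \<otimes> x \<preceq> x \<otimes> y")
      case True
      note * = pow_mult_between[OF this x y, of n]
      show ?thesis
        using le_trans[OF ab(2) le_trans[OF *(1,2)]] le_trans[OF *(3) ab'(1)] by simp
    next
      case False
      then have "x \<otimes> y \<preceq> y \<otimes> x" using le_linear[of "x \<otimes> y" "y \<otimes> x"] by simp
      note * = pow_mult_between[OF this y x, of n]
      show ?thesis
        using le_trans[OF ab(1) *(1)] le_trans[OF le_trans[OF *(2,3)] ab'(2)] by simp
    qed
    then have "real_of_int (a + b) \<le> real n * slope (x \<otimes> y)"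
      "real n * slope (x \<otimes> y) \<le> real_of_int (a + b + 2)"
      using slope_bounds[of "x \<otimes> y" n] n x y by (blast intro: m_closed)+
    moreover have "real_of_int a \<le> real n * slope x" "real n * slope x \<le> real_of_int (a + 1)"
      "real_of_int b \<le> real n * slope y" "real n * slope y \<le> real_of_int (b + 1)"
      using slope_bounds[OF x n] slope_bounds[OF y n] a b by blast+
    ultimately have "\<bar>real n * slope (x \<otimes> y) - (real n * slope x + real n * slope y)\<bar> \<le> 2"
      by simp
    moreover have "real n * slope (x \<otimes> y) - (real n * slope x + real n * slope y)
        = real n * (slope (x \<otimes> y) - (slope x + slope y))"
      by (simp add: algebra_simps)
    ultimately show ?thesis by (simp add: abs_mult)
  qed
  show ?thesis
  proof (rule ccontr)
    assume "slope (x \<otimes> y) \<noteq> slope x + slope y"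
    then have "0 < \<bar>slope (x \<otimes> y) - (slope x + slope y)\<bar>" by simp
    then obtain n :: nat where n: "2 < real n * \<bar>slope (x \<otimes> y) - (slope x + slope y)\<bar>"
      using reals_Archimedean3 by blast
    then have "0 < n" by (cases n) auto
    then show False using bound[of n] n by simp
  qed
qed

lemma slope_nonneg:
  assumes "x \<in> P"
  shows "0 \<le> slope x"
proof -
  have "m [^] (0::int) \<preceq> x [^] (1::nat)" using assms by (simp add: le_def)
  from slope_bounds(1)[OF _ _ this] show ?thesis using assms by simp
qed

lemma slope_ge_1:
  assumes "x \<in> carrier G" "m \<preceq> x"
  shows "1 \<le> slope x"
proof -
  have "m [^] (1::int) \<preceq> x [^] (1::nat)" using assms by simp
  from slope_bounds(1)[OF _ _ this] show ?thesis using assms by simp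
qed

lemma slope_m: "slope m = 1"
  using slope_bounds(1)[of m 1 1] slope_bounds(2)[of m 1 1] by simp

lemma slope_one: "slope \<one> = 0"
  using slope_mult[of \<one> \<one>] by simp

lemma slope_inv: "x \<in> carrier G \<Longrightarrow> slope (inv x) = - slope x"
  using slope_mult[of x "inv x"] by (simp add: slope_one)

lemma slope_nat_pow: "x \<in> carrier G \<Longrightarrow> slope (x [^] (n::nat)) = real n * slope x"
  by (induction n) (auto simp: slope_one slope_mult algebra_simps)

lemma slope_int_pow: "x \<in> carrier G \<Longrightarrow> slope (x [^] (k::int)) = real_of_int k * slope x"
  by (cases k rule: int_cases2) (auto simp: int_pow_neg int_pow_int slope_inv slope_nat_pow)

lemma P_of_slope_pos: "x \<in> carrier G \<Longrightarrow> 0 < slope x \<Longrightarrow> x \<in> P"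
  using P_total[of x] slope_nonneg[of "inv x"] by (cases "x = \<one>") (auto simp: slope_one slope_inv)

end

section \<open>Perturbing a discrete bi-ordering\<close>

text \<open>
  For irrational \<open>v\<close> the numbers \<open>1\<close> and \<open>v\<close> are linearly independent over the rationals, so the values
  of a rational-linear functional at both can be prescribed.
\<close>

lemma additive_functional_exists:
  fixes v :: real
  assumes v: "v \<notin> \<rat>"
  shows "\<exists>L :: real \<Rightarrow> real. (\<forall>x y. L (x + y) = L x + L y) \<and> L 1 = 0 \<and> L v = 1"
proof -
  let ?scale = "\<lambda>(q::rat) (x::real). of_rat q * x"
  interpret vs: vector_space ?scale
    by unfold_locales (auto simp: algebra_simps of_rat_add of_rat_mult)
  interpret vector_space_pair ?scale ?scale ..
  have "v \<notin> vs.span {1}"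
    using v by (auto simp: vs.span_singleton)
  then have ind: "vs.independent {v, 1}"
    by (auto simp: vs.independent_insert)
  have "v \<noteq> 1" using v by auto
  obtain L where L: "Vector_Spaces.linear ?scale ?scale L"
    "\<forall>x\<in>{v, 1}. L x = (if x = v then 1 else 0)"
    using linear_independent_extend[OF ind, of "\<lambda>x. if x = v then 1 else 0"] by blast
  interpret L: Vector_Spaces.linear ?scale ?scale L by (rule L(1))
  show ?thesis
    using L(2) \<open>v \<noteq> 1\<close> L.add by (intro exI[of _ L]) auto
qed

context bi_ordered_group_cofinal
begin

text \<open>
  Perturb the slope by a small multiple of a second homomorphism. Elements above \<open>m\<close> have slope at
  least one, so finitely many of them stay positive. The last hypothesis says that the perturbation
  changes the order, however small it is.
\<close>

lemma perturbed_cone_exists: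
  fixes \<psi> :: "'a \<Rightarrow> real"
  assumes hom: "\<And>x y. x \<in> carrier G \<Longrightarrow> y \<in> carrier G \<Longrightarrow> \<psi> (x \<otimes> y) = \<psi> x + \<psi> y"
    and F: "finite F" "\<And>f. f \<in> F \<Longrightarrow> f \<in> carrier G \<and> m \<preceq> f"
    and e: "e \<in> P" "0 \<le> \<psi> e"
    and change: "\<And>d. 0 < d \<Longrightarrow> \<exists>x\<in>P. slope x + d * \<psi> x < 0"
  shows "\<exists>Q. left_cone G Q \<and> e \<in> Q \<and> F \<subseteq> Q \<and> Q \<noteq> P"
proof -
  \<comment> \<open>The choice of \<open>d\<close> makes \<open>d * \<bar>\<psi> f\<bar> < 1 \<le> slope f\<close> for all \<open>f \<in> F\<close>.\<close>
  define d where "d = 1 / (1 + (\<Sum>f\<in>F. \<bar>\<psi> f\<bar>))"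
  have sum: "0 \<le> (\<Sum>f\<in>F. \<bar>\<psi> f\<bar>)" by (simp add: sum_nonneg)
  then have d: "0 < d" unfolding d_def by (intro divide_pos_pos) linarith+
  define \<theta> where "\<theta> x = slope x + d * \<psi> x" for x
  let ?Q = "{x \<in> carrier G. \<theta> x > 0 \<or> \<theta> x = 0 \<and> x \<in> P}"
  have cone: "left_cone G ?Q"
    by (rule left_cone_lex) (simp add: \<theta>_def slope_mult hom algebra_simps)
  have "0 < \<theta> f" if f: "f \<in> F" for f
  proof -
    have "\<bar>\<psi> f\<bar> \<le> (\<Sum>f\<in>F. \<bar>\<psi> f\<bar>)" using F(1) f by (intro member_le_sum) auto
    then have "d * \<bar>\<psi> f\<bar> < 1" using sum by (simp add: d_def field_simps)
    then have "- (d * \<psi> f) < 1" using d by (smt (verit) mult_minus_right mult_left_mono)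
    moreover have "1 \<le> slope f" using slope_ge_1 F(2)[OF f] by blast
    ultimately show ?thesis by (simp add: \<theta>_def)
  qed
  then have "F \<subseteq> ?Q" using F(2) by blast
  moreover have "0 \<le> \<theta> e"
    using e d slope_nonneg[OF e(1)] by (simp add: \<theta>_def)
  then have "e \<in> ?Q" using e(1) by auto
  moreover obtain x where "x \<in> P" "x \<notin> ?Q"
    using change[OF d] by (force simp: \<theta>_def)
  ultimately show ?thesis using cone by blast
qed

text \<open>
  Compose the slope with a rational-linear functional that vanishes at \<open>1\<close> but not at the irrational
  slope of \<open>y\<close>. The perturbation then increases the slope of \<open>y\<close> by \<open>d\<close> relative to the unit \<open>m\<close>, which
  reverses the comparison with a rational number in the gap.
\<close>

lemma perturbed_cone_exists_if_irrational_slope: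
  assumes F: "finite F" "\<And>f. f \<in> F \<Longrightarrow> f \<in> carrier G \<and> m \<preceq> f"
    and e: "e \<in> P" "slope e = 0"
    and y: "y \<in> carrier G" "slope y \<notin> \<rat>"
  shows "\<exists>Q. left_cone G Q \<and> e \<in> Q \<and> F \<subseteq> Q \<and> Q \<noteq> P"
proof -
  obtain L :: "real \<Rightarrow> real" where L: "\<And>x y. L (x + y) = L x + L y" "L 1 = 0" "L (slope y) = 1"
    using additive_functional_exists[OF y(2)] by blast
  have L0: "L 0 = 0" using L(1)[of 0 0] by simp
  define \<psi> where "\<psi> x = L (slope x)" for x
  have hom: "\<psi> (x \<otimes> z) = \<psi> x + \<psi> z" if "x \<in> carrier G" "z \<in> carrier G" for x z
    using that by (simp add: \<psi>_def slope_mult L)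
  have \<psi>_one: "\<psi> \<one> = 0" by (simp add: \<psi>_def slope_one L0)
  have \<psi>_inv: "\<psi> (inv x) = - \<psi> x" if "x \<in> carrier G" for x
    using hom[of x "inv x"] that by (simp add: \<psi>_one)
  have \<psi>_nat: "\<psi> (x [^] n) = real n * \<psi> x" if "x \<in> carrier G" for x and n :: nat
    by (induction n) (use that in \<open>auto simp: \<psi>_one hom algebra_simps\<close>)
  have \<psi>_int: "\<psi> (x [^] k) = real_of_int k * \<psi> x" if "x \<in> carrier G" for x and k :: int
    using that by (cases k rule: int_cases2) (auto simp: int_pow_neg int_pow_int \<psi>_inv \<psi>_nat)
  have "\<exists>x\<in>P. slope x + d * \<psi> x < 0" if d: "0 < d" for d
  proof -
    obtain r where r: "r \<in> \<rat>" "slope y < r" "r < slope y + d"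
      using Rats_dense_in_real[of "slope y" "slope y + d"] d by auto
    then obtain a b :: int where ab: "0 < b" "r = of_int a / of_int b"
      by (auto elim: Rats_cases')
    \<comment> \<open>Its slope is positive because \<open>slope y < a / b\<close>, its perturbed slope negative because \<open>a / b < slope y + d\<close>.\<close>
    let ?x = "m [^] a \<otimes> y [^] (- b)"
    have x: "?x \<in> carrier G" using y by simp
    have sx: "slope ?x = real_of_int a - real_of_int b * slope y"
      using y by (simp add: slope_mult slope_int_pow slope_m)
    have px: "\<psi> ?x = - real_of_int b"
      using y by (simp add: hom \<psi>_int) (simp add: \<psi>_def slope_m L)
    have "0 < slope ?x" using r(2) ab by (simp add: sx field_simps)
    then have "?x \<in> P" using P_of_slope_pos[OF x] by simp
    moreover have "slope ?x + d * \<psi> ?x < 0"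
      using r(3) ab by (simp add: sx px field_simps)
    ultimately show ?thesis by blast
  qed
  then show ?thesis
    using perturbed_cone_exists[of \<psi> F e] hom F e by (simp add: \<psi>_def L0)
qed

end

text \<open>
  The last assumption puts \<open>m\<close> above all powers of \<open>e\<close>, so that \<open>e\<close> is infinitesimal compared with \<open>m\<close>.
\<close>

locale discrete_bi_ordered_group = bi_ordered_group_cofinal +
  fixes e
  assumes e_pos: "e \<in> P"
    and e_least: "x \<in> P \<Longrightarrow> e \<preceq> x"
    and m_not_power: "m \<notin> range (\<lambda>k::int. e [^] k)"
begin

abbreviation C where "C \<equiv> range (\<lambda>k::int. e [^] k)"

lemma e_carrier [simp]: "e \<in> carrier G"
  using e_pos by simp

text \<open>
  Conjugation preserves the order and therefore its least positive element.
\<close>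

lemma e_central:
  assumes g: "g \<in> carrier G"
  shows "e \<otimes> g = g \<otimes> e"
proof (rule le_antisym)
  have "e \<preceq> inv g \<otimes> e \<otimes> g" by (rule e_least[OF P_conj[OF e_pos g]])
  from le_mult_left[OF this, of g] show "g \<otimes> e \<preceq> e \<otimes> g"
    using g by (simp add: m_assoc)
  have "e \<preceq> inv (inv g) \<otimes> e \<otimes> inv g"
    using g by (intro e_least P_conj e_pos) auto
  from le_mult_right[OF this, of g] show "e \<otimes> g \<preceq> g \<otimes> e"
    using g by (simp add: m_assoc)
qed (use g in auto)

lemma convex_C: "convex_subgroup C"
  using convex_subgroup_least_powers[OF e_pos e_least] .

lemma slope_e: "slope e = 0"
proof (rule ccontr)
  assume "slope e \<noteq> 0"
  then have "0 < slope e" using slope_nonneg[OF e_pos] by simp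
  then obtain n :: nat where n: "1 < real n * slope e"
    using reals_Archimedean3 by blast
  have "m \<otimes> e [^] (- int n) \<in> P"
    using convex_subgroup_mult_right[OF convex_C, of "e [^] (- int n)" m] m_pos m_not_power by blast
  then have "0 \<le> slope (m \<otimes> e [^] (- int n))" by (rule slope_nonneg)
  then show False using n by (simp add: slope_mult slope_int_pow slope_m)
qed

lemma e_int_pow_inj: 
  assumes "e [^] (i::int) = e [^] j"
  shows "i = j"
proof -
  have "i = j" if "e [^] i = e [^] j" "i \<le> j" for i j :: int
  proof (rule ccontr)
    assume "i \<noteq> j"
    then have "e [^] nat (j - i) \<in> P" using P_nat_pow[OF e_pos, of "nat (j - i)"] that by simp
    moreover have "e [^] nat (j - i) = e [^] j \<otimes> inv (e [^] i)"
      using that(2) by (simp flip: int_pow_int add: int_pow_diff)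
    ultimately show False using that(1) by simp
  qed
  from this[of i j] this[of j i] assms show ?thesis by force
qed

text \<open>
  The kernel of the slope is strictly larger than \<open>C\<close>, so the order can be reversed on the kernel
  outside \<open>C\<close>, where it matters neither for \<open>e\<close> nor for elements above \<open>m\<close>.
\<close>

lemma perturbed_cone_exists_if_small_elements:
  assumes F: "finite F" "\<And>f. f \<in> F \<Longrightarrow> f \<in> carrier G \<and> m \<preceq> f"
    and x: "x \<in> P" "slope x = 0" "x \<notin> C"
  shows "\<exists>Q. left_cone G Q \<and> e \<in> Q \<and> F \<subseteq> Q \<and> Q \<noteq> P"
proof -
  define S where "S = {x \<in> carrier G. inv x \<in> P - C} \<union> (P \<inter> C)"
  interpret S: left_ordered_group G S
    by unfold_locales (simp only: S_def left_cone_flip_above_convex_subgroup[OF convex_C])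
  let ?Q = "{x \<in> carrier G. slope x > 0 \<or> slope x = 0 \<and> x \<in> S}"
  have cone: "left_cone G ?Q" by (rule S.left_cone_lex) (rule slope_mult)
  have "F \<subseteq> ?Q" using F(2) slope_ge_1 by fastforce
  moreover have "e \<in> C" by (rule range_eqI[of _ _ 1]) simp
  then have "e \<in> S" using e_pos unfolding S_def by blast
  then have "e \<in> ?Q" by (simp add: slope_e)
  moreover have "x \<notin> S" using x P_inv[of x] unfolding S_def by blast
  then have "x \<notin> ?Q" using x(2) by simp
  ultimately show ?thesis using cone x(1) by blast
qed

text \<open>
  If all slopes are rational and \<open>C\<close> is the kernel of the slope, then every element has a power of the form
  \<open>m [^] p \<otimes> e [^] j\<close>. As \<open>e\<close> is central, uniqueness of roots makes the group commutative, and
  \<open>m\<close> and \<open>e\<close> form a rational basis. The homomorphism \<open>\<psi>\<close> below is the coordinate with respect to \<open>e\<close>.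
  Perturbing the slope by it makes \<open>e\<close> comparable in size to \<open>m\<close>: for large \<open>k\<close> the element
  \<open>m \<otimes> e [^] (- k)\<close> becomes negative.
\<close>

lemma perturbed_cone_exists_if_rational_slopes:
  assumes F: "finite F" "\<And>f. f \<in> F \<Longrightarrow> f \<in> carrier G \<and> m \<preceq> f"
    and small: "\<And>x. x \<in> P \<Longrightarrow> slope x = 0 \<Longrightarrow> x \<in> C"
    and rational: "\<And>x. x \<in> carrier G \<Longrightarrow> slope x \<in> \<rat>"
  shows "\<exists>Q. left_cone G Q \<and> e \<in> Q \<and> F \<subseteq> Q \<and> Q \<noteq> P"
proof -
  interpret C: subgroup C G using convex_C by (simp add: convex_subgroup_def)
  have kernel: "x \<in> C" if x: "x \<in> carrier G" "slope x = 0" for x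
  proof -
    consider "x = \<one>" | "x \<in> P" | "inv x \<in> P" using P_total[OF x(1)] by blast
    then show ?thesis
    proof cases
      case 3
      then have "inv x \<in> C" using small[of "inv x"] x by (simp add: slope_inv)
      then show ?thesis using C.m_inv_closed[of "inv x"] x by simp
    qed (use small x C.one_closed in auto)
  qed
  have e_pow_central: "e [^] (j::int) \<otimes> g = g \<otimes> e [^] j" if "g \<in> carrier G" for g j
    using int_pow_commute[OF e_central[OF that]] that by simp
  have relation: "\<exists>n p j. 0 < (n::nat) \<and> x [^] n = m [^] (p::int) \<otimes> e [^] (j::int)"
    if x: "x \<in> carrier G" for x
  proof -
    obtain p b :: int where pb: "0 < b" "slope x = of_int p / of_int b"
      using rational[OF x] by (auto elim: Rats_cases')
    define n where "n = nat b"
    have n: "0 < n" "real n * slope x = of_int p" using pb by (auto simp: n_def)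
    have "slope (inv (m [^] p) \<otimes> x [^] n) = 0"
      using x n by (simp add: slope_mult slope_inv slope_int_pow slope_nat_pow slope_m)
    then have "inv (m [^] p) \<otimes> x [^] n \<in> C" using kernel x by simp
    then obtain j :: int where "inv (m [^] p) \<otimes> x [^] n = e [^] j" by blast
    then have "x [^] n = m [^] p \<otimes> e [^] j" using x by (metis inv_mult_cancel(2) m_carrier int_pow_closed nat_pow_closed)
    then show ?thesis using n(1) by blast
  qed
  have commute_if: "x \<otimes> y = y \<otimes> x"
    if x: "x \<in> carrier G" and y: "y \<in> carrier G" and "m \<otimes> y = y \<otimes> m" for x y
  proof -
    obtain n p j where n: "0 < (n::nat)" "x [^] n = m [^] (p::int) \<otimes> e [^] (j::int)"
      using relation[OF x] by blast
    have "m [^] p \<otimes> e [^] j \<otimes> y = m [^] p \<otimes> (y \<otimes> e [^] j)"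
      using y by (simp add: m_assoc e_pow_central)
    also have "\<dots> = y \<otimes> (m [^] p \<otimes> e [^] j)"
      using y int_pow_commute[OF that(3), of p] by (simp flip: m_assoc)
    finally show ?thesis using commute_of_nat_pow_commute[OF _ n(1) x y] n(2) by simp
  qed
  have comm: "x \<otimes> y = y \<otimes> x" if "x \<in> carrier G" "y \<in> carrier G" for x y
    using commute_if[OF that] commute_if[of y m] that by simp
  interpret comm_group G by (rule group_comm_groupI) (rule comm)
  \<comment> \<open>The exponent ratio \<open>j / n\<close> is the same for all relations, because the slope determines \<open>p / n\<close>.\<close>
  define \<psi> where "\<psi> x = (THE r. \<exists>n p j. 0 < (n::nat)
      \<and> x [^] n = m [^] (p::int) \<otimes> e [^] (j::int) \<and> r = real_of_int j / real n)" for x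
  have \<psi>_eq: "\<psi> x = real_of_int j / real n"
    if x: "x \<in> carrier G" and n: "0 < n" and rel: "x [^] n = m [^] p \<otimes> e [^] j"
    for x and n :: nat and p j :: int
  proof -
    have "real_of_int j' / real n' = real_of_int j / real n"
      if n': "0 < n'" and rel': "x [^] n' = m [^] p' \<otimes> e [^] j'" for n' :: nat and p' j' :: int
    proof -
      have slopes: "of_int p = real n * slope x" "of_int p' = real n' * slope x"
        using arg_cong[OF rel, of slope] arg_cong[OF rel', of slope] x
        by (simp_all add: slope_mult slope_int_pow slope_nat_pow slope_m slope_e)
      have "real_of_int (p * int n') = real_of_int (p' * int n)"
        by (simp add: slopes)
      then have p: "p * int n' = p' * int n" using of_int_eq_iff by blast
      have "(x [^] n) [^] n' = (x [^] n') [^] n" using x by (simp add: nat_pow_pow mult.commute)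
      then have "m [^] (p * int n') \<otimes> e [^] (j * int n') = m [^] (p' * int n) \<otimes> e [^] (j' * int n)"
        by (simp add: rel rel' nat_pow_distrib int_pow_nat_pow)
      then have "e [^] (j * int n') = e [^] (j' * int n)" by (simp add: p)
      then have "j * int n' = j' * int n" by (rule e_int_pow_inj)
      then have "real_of_int j * real n' = real_of_int j' * real n"
        by (metis of_int_mult of_int_of_nat_eq)
      then show ?thesis using n n' by (simp add: field_simps)
    qed
    then show ?thesis
      unfolding \<psi>_def using n rel by (intro the_equality) blast+
  qed
  have hom: "\<psi> (x \<otimes> y) = \<psi> x + \<psi> y" if x: "x \<in> carrier G" and y: "y \<in> carrier G" for x y
  proof -
    obtain n p j where n: "0 < (n::nat)" "x [^] n = m [^] (p::int) \<otimes> e [^] (j::int)"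
      using relation[OF x] by blast
    obtain n' p' j' where n': "0 < (n'::nat)" "y [^] n' = m [^] (p'::int) \<otimes> e [^] (j'::int)"
      using relation[OF y] by blast
    have "(x \<otimes> y) [^] (n * n') = (x [^] n) [^] n' \<otimes> (y [^] n') [^] n"
      using x y by (simp add: nat_pow_distrib nat_pow_pow mult.commute)
    also have "\<dots> = (m [^] (p * int n') \<otimes> e [^] (j * int n')) \<otimes> (m [^] (p' * int n) \<otimes> e [^] (j' * int n))"
      by (simp add: n(2) n'(2) nat_pow_distrib int_pow_nat_pow)
    also have "\<dots> = m [^] (p * int n' + p' * int n) \<otimes> e [^] (j * int n' + j' * int n)"
      by (simp add: m_ac int_pow_mult)
    finally have "\<psi> (x \<otimes> y) = real_of_int (j * int n' + j' * int n) / real (n * n')"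
      using \<psi>_eq[of "x \<otimes> y" "n * n'"] x y n(1) n'(1) by simp
    also have "\<dots> = real_of_int j / real n + real_of_int j' / real n'"
      using n(1) n'(1) by (simp add: field_simps)
    finally show ?thesis
      using \<psi>_eq[OF x n] \<psi>_eq[OF y n'] by simp
  qed
  have "\<psi> e = 1" using \<psi>_eq[of e 1 0 1] by simp
  have "\<exists>x\<in>P. slope x + d * \<psi> x < 0" if d: "0 < d" for d
  proof -
    obtain k :: nat where k: "1 < real k * d" using reals_Archimedean3[OF d] by blast
    let ?x = "m \<otimes> e [^] (- int k)"
    have "?x \<in> P"
      using convex_subgroup_mult_right[OF convex_C, of "e [^] (- int k)" m] m_pos m_not_power by blast
    moreover have "slope ?x = 1" by (simp add: slope_mult slope_int_pow slope_m slope_e)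
    moreover have "\<psi> ?x = - real k" using \<psi>_eq[of ?x 1 1 "- int k"] by simp
    ultimately show ?thesis using k by (intro bexI[of _ ?x]) (auto simp: mult.commute)
  qed
  then show ?thesis
    using perturbed_cone_exists[of \<psi> F e] hom F e_pos \<open>\<psi> e = 1\<close> by simp
qed

theorem perturbed_cone_exists_discrete:
  assumes "finite F" "\<And>f. f \<in> F \<Longrightarrow> f \<in> carrier G \<and> m \<preceq> f"
  shows "\<exists>Q. left_cone G Q \<and> e \<in> Q \<and> F \<subseteq> Q \<and> Q \<noteq> P"
  using perturbed_cone_exists_if_small_elements[of F] perturbed_cone_exists_if_rational_slopes[of F]
    perturbed_cone_exists_if_irrational_slope[of F e] assms e_pos slope_e by blast

end

context left_ordered_group
begin

section \<open>Finitely determined cones\<close>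

lemma left_cone_conj:
  assumes x [simp]: "x \<in> carrier G"
  shows "left_cone G {g \<in> carrier G. inv x \<otimes> g \<otimes> x \<in> P}"
proof -
  have mult: "inv x \<otimes> (g \<otimes> h) \<otimes> x \<in> P"
    if "g \<in> carrier G" "h \<in> carrier G" "inv x \<otimes> g \<otimes> x \<in> P" "inv x \<otimes> h \<otimes> x \<in> P" for g h
    using P_mult[OF that(3,4)] that(1,2) by (simp add: m_assoc)
  have total: "inv x \<otimes> g \<otimes> x \<in> P \<or> inv x \<otimes> inv g \<otimes> x \<in> P" if g: "g \<in> carrier G" "g \<noteq> \<one>" for g
  proof -
    have "inv x \<otimes> g \<otimes> x \<noteq> \<one>"
    proof
      assume "inv x \<otimes> g \<otimes> x = \<one>"
      then have "x \<otimes> (inv x \<otimes> g \<otimes> x) \<otimes> inv x = \<one>" by simp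
      then show False using g by (simp add: m_assoc)
    qed
    moreover have "inv (inv x \<otimes> g \<otimes> x) = inv x \<otimes> inv g \<otimes> x"
      using g by (simp add: inv_mult_group m_assoc)
    ultimately show ?thesis using P_total[of "inv x \<otimes> g \<otimes> x"] g by auto
  qed
  show ?thesis
    unfolding left_cone_def using mult total by auto
qed

definition cone_stabilizer :: "'a set"
  where "cone_stabilizer = {x \<in> carrier G. \<forall>g\<in>carrier G. inv x \<otimes> g \<otimes> x \<in> P \<longleftrightarrow> g \<in> P}"

lemma cone_stabilizerD:
  "x \<in> cone_stabilizer \<Longrightarrow> g \<in> carrier G \<Longrightarrow> inv x \<otimes> g \<otimes> x \<in> P \<longleftrightarrow> g \<in> P"
  by (simp add: cone_stabilizer_def)

lemma subgroup_cone_stabilizer: "subgroup cone_stabilizer G"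
proof (rule subgroupI)
  show "inv a \<in> cone_stabilizer" if a: "a \<in> cone_stabilizer" for a
  proof -
    have [simp]: "a \<in> carrier G" using a by (simp add: cone_stabilizer_def)
    have "a \<otimes> g \<otimes> inv a \<in> P \<longleftrightarrow> g \<in> P" if g: "g \<in> carrier G" for g
    proof -
      have "inv a \<otimes> (a \<otimes> g \<otimes> inv a) \<otimes> a \<in> P \<longleftrightarrow> a \<otimes> g \<otimes> inv a \<in> P"
        using a g by (simp add: cone_stabilizer_def)
      then show ?thesis using g by (simp add: m_assoc)
    qed
    then show ?thesis by (simp add: cone_stabilizer_def)
  qed
  show "a \<otimes> b \<in> cone_stabilizer" if ab: "a \<in> cone_stabilizer" "b \<in> cone_stabilizer" for a b
  proof -
    have [simp]: "a \<in> carrier G" "b \<in> carrier G" using ab by (simp_all add: cone_stabilizer_def)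
    have "inv (a \<otimes> b) \<otimes> g \<otimes> (a \<otimes> b) \<in> P \<longleftrightarrow> g \<in> P" if g: "g \<in> carrier G" for g
    proof -
      have "inv (a \<otimes> b) \<otimes> g \<otimes> (a \<otimes> b) = inv b \<otimes> (inv a \<otimes> g \<otimes> a) \<otimes> b"
        using g by (simp add: m_assoc inv_mult_group)
      then show ?thesis using ab g by (simp add: cone_stabilizer_def)
    qed
    then show ?thesis by (simp add: cone_stabilizer_def)
  qed
qed (auto simp: cone_stabilizer_def)

text \<open>
  The two conditions say that \<open>x\<close> and its inverse lie above the inverse of a power of \<open>m\<close>. When
  conjugation by \<open>m\<close> preserves the order, this means that \<open>x\<close> lies between two powers of \<open>m\<close>.
\<close>

definition bounded_by_powers :: "'a \<Rightarrow> 'a set"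
  where "bounded_by_powers m =
    {x \<in> carrier G. \<exists>k::nat. m [^] k \<otimes> x \<in> P \<and> m [^] k \<otimes> inv x \<in> P}"

lemma bounded_by_powersI:
  "\<lbrakk>x \<in> carrier G; m [^] (k::nat) \<otimes> x \<in> P; m [^] k \<otimes> inv x \<in> P\<rbrakk> \<Longrightarrow> x \<in> bounded_by_powers m"
  by (auto simp: bounded_by_powers_def)

lemma bounded_by_powersE:
  assumes "x \<in> bounded_by_powers m"
  obtains k :: nat where "x \<in> carrier G" "m [^] k \<otimes> x \<in> P" "m [^] k \<otimes> inv x \<in> P"
  using assms by (auto simp: bounded_by_powers_def)

context
  fixes m
  assumes m [simp]: "m \<in> P"
    and below_m: "\<And>x. x \<in> P \<Longrightarrow> x \<preceq> m \<Longrightarrow> x \<in> cone_stabilizer"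
begin

interpretation N: subgroup cone_stabilizer G by (rule subgroup_cone_stabilizer)

lemma m_nat_pow_stabilizer: "m [^] (k::nat) \<in> cone_stabilizer"
  by (induction k) (use N.m_closed below_m[OF m le_refl] in auto)

lemma m_pow_conj:
  assumes "g \<in> carrier G"
  shows "inv (m [^] (k::nat)) \<otimes> g \<otimes> m [^] k \<in> P \<longleftrightarrow> g \<in> P"
  by (rule cone_stabilizerD[OF m_nat_pow_stabilizer assms])

lemma m_pow_swap:
  assumes g: "g \<in> carrier G"
  shows "m [^] (k::nat) \<otimes> g \<in> P \<longleftrightarrow> g \<otimes> m [^] k \<in> P"
  using m_pow_conj[of "m [^] k \<otimes> g" k] g by (simp add: m_assoc)

text \<open>
  Dividing by \<open>m\<close> moves an element from one interval between consecutive powers of \<open>m\<close> to the preceding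
  one, and finally below \<open>m\<close>.
\<close>

lemma below_m_pow_stabilizer:
  assumes "x \<in> P" "inv x \<otimes> m [^] (k::nat) \<in> P"
  shows "x \<in> cone_stabilizer"
  using assms
proof (induction k arbitrary: x)
  case 0
  then show ?case using P_inv[of x] by simp
next
  case (Suc k)
  show ?case
  proof (cases "x \<preceq> m")
    case True
    then show ?thesis using below_m Suc.prems by blast
  next
    case False
    then have "inv m \<otimes> x \<in> P"
      using le_linear[of x m] Suc.prems(1) by (auto simp: le_def)
    moreover have "inv (inv m \<otimes> x) \<otimes> m [^] k \<in> P"
    proof -
      have "inv (inv m \<otimes> x) \<otimes> m [^] k = inv x \<otimes> m [^] Suc k"
        using Suc.prems(1) by (simp only: nat_pow_Suc2[OF P_carrier[OF m]]) (simp add: inv_mult_group m_assoc)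
      then show ?thesis using Suc.prems(2) by simp
    qed
    ultimately have "inv m \<otimes> x \<in> cone_stabilizer" by (rule Suc.IH)
    then have "m \<otimes> (inv m \<otimes> x) \<in> cone_stabilizer"
      by (rule N.m_closed[OF below_m[OF m le_refl]])
    then show ?thesis using Suc.prems(1) by simp
  qed
qed

lemma bounded_subset_stabilizer: "bounded_by_powers m \<subseteq> cone_stabilizer"
proof
  fix x assume "x \<in> bounded_by_powers m"
  then obtain k :: nat where x: "x \<in> carrier G" "m [^] k \<otimes> x \<in> P" "m [^] k \<otimes> inv x \<in> P"
    by (auto simp: bounded_by_powers_def)
  consider "x = \<one>" | "x \<in> P" | "inv x \<in> P" using P_total[OF x(1)] by blast
  then show "x \<in> cone_stabilizer"
  proof cases
    case 2
    then show ?thesis using below_m_pow_stabilizer[of x k] x m_pow_swap[of "inv x" k] by simp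
  next
    case 3
    then have "inv x \<in> cone_stabilizer"
      using below_m_pow_stabilizer[of "inv x" k] x m_pow_swap[of x k] by simp
    then show ?thesis using N.m_inv_closed[of "inv x"] x by simp
  qed (use N.one_closed in simp)
qed

lemma subgroup_bounded: "subgroup (bounded_by_powers m) G"
proof (rule subgroupI)
  have "\<one> \<in> bounded_by_powers m"
    by (rule bounded_by_powersI[of _ _ 1]) (use m in auto)
  then show "bounded_by_powers m \<noteq> {}" by blast
  show "inv a \<in> bounded_by_powers m" if "a \<in> bounded_by_powers m" for a
    using that by (auto simp: bounded_by_powers_def)
  have mult: "m [^] (l + k) \<otimes> (a \<otimes> b) \<in> P"
    if "a \<in> carrier G" "b \<in> carrier G" "m [^] k \<otimes> a \<in> P" "m [^] l \<otimes> b \<in> P" for a b and k l :: nat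
  proof -
    have "b \<otimes> m [^] l \<in> P" using that m_pow_swap by blast
    then have "(m [^] k \<otimes> a) \<otimes> (b \<otimes> m [^] l) \<in> P" using that by blast
    then have "(m [^] k \<otimes> a \<otimes> b) \<otimes> m [^] l \<in> P" using that by (simp add: m_assoc)
    then have "m [^] l \<otimes> (m [^] k \<otimes> a \<otimes> b) \<in> P" using that by (subst m_pow_swap) auto
    then show ?thesis using that by (simp add: m_assoc flip: nat_pow_mult)
  qed
  show "a \<otimes> b \<in> bounded_by_powers m" if ab: "a \<in> bounded_by_powers m" "b \<in> bounded_by_powers m" for a b
  proof -
    obtain k l :: nat where a: "a \<in> carrier G" "m [^] k \<otimes> a \<in> P" "m [^] k \<otimes> inv a \<in> P"
      and b: "b \<in> carrier G" "m [^] l \<otimes> b \<in> P" "m [^] l \<otimes> inv b \<in> P"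
      using ab by (auto simp: bounded_by_powers_def)
    have "m [^] (l + k) \<otimes> (a \<otimes> b) \<in> P" using mult a b by blast
    moreover have "m [^] (k + l) \<otimes> (inv b \<otimes> inv a) \<in> P" using mult[of "inv b" "inv a" l k] a b by simp
    ultimately show ?thesis
      using a b unfolding bounded_by_powers_def
      by (auto simp: inv_mult_group add.commute intro!: exI[of _ "k + l"])
  qed
qed (auto simp: bounded_by_powers_def)

lemma convex_bounded: "convex_subgroup (bounded_by_powers m)"
proof -
  interpret H: subgroup "bounded_by_powers m" G by (rule subgroup_bounded)
  have "h \<otimes> g \<in> P" if h: "h \<in> bounded_by_powers m" and g: "g \<in> P - bounded_by_powers m" for h g
  proof (rule ccontr)
    assume not_P: "h \<otimes> g \<notin> P"
    obtain k :: nat where k: "m [^] k \<otimes> h \<in> P" using h by (rule bounded_by_powersE)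
    have [simp]: "h \<in> carrier G" "g \<in> carrier G" using h g by auto
    have "h \<otimes> g \<noteq> \<one>"
    proof
      assume "h \<otimes> g = \<one>"
      then have "g = inv h" by (metis \<open>h \<in> carrier G\<close> \<open>g \<in> carrier G\<close> inv_equality inv_inv)
      then show False using g h H.m_inv_closed by blast
    qed
    then have "inv (h \<otimes> g) \<in> P" using not_P P_total[of "h \<otimes> g"] by simp
    moreover have "h \<otimes> m [^] k \<in> P" using k m_pow_swap by simp
    ultimately have "inv (h \<otimes> g) \<otimes> (h \<otimes> m [^] k) \<in> P" by blast
    then have "inv g \<otimes> m [^] k \<in> P" by (simp add: inv_mult_group m_assoc)
    then have "m [^] k \<otimes> inv g \<in> P" using m_pow_swap by simp
    moreover have "m [^] k \<otimes> g \<in> P"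
      using P_nat_pow[OF m, of k] g by (cases "k = 0") auto
    ultimately have "g \<in> bounded_by_powers m" by (intro bounded_by_powersI[of g m k]) auto
    then show False using g by simp
  qed
  then show ?thesis using subgroup_bounded by (simp add: convex_subgroup_def)
qed

lemma m_bounded: "m \<in> bounded_by_powers m"
proof -
  \<comment> \<open>The exponent one would not do, since \<open>m \<otimes> inv m\<close> is not positive.\<close>
  have "m [^] Suc (Suc 0) \<otimes> m \<in> P" "m [^] Suc (Suc 0) \<otimes> inv m \<in> P"
    using P_mult[OF P_mult[OF m m] m] by (simp_all add: m_assoc)
  then show ?thesis by (rule bounded_by_powersI[OF P_carrier[OF m]])
qed

lemma bi_ordered_bounded:
  "bi_ordered_group_cofinal (G\<lparr>carrier := bounded_by_powers m\<rparr>) (P \<inter> bounded_by_powers m) m"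
proof -
  let ?H = "bounded_by_powers m"
  let ?GH = "G\<lparr>carrier := ?H\<rparr>"
  have sub: "subgroup ?H G" by (rule subgroup_bounded)
  interpret H: subgroup ?H G by (rule sub)
  have inv: "inv\<^bsub>?GH\<^esub> x = inv x" if "x \<in> ?H" for x
    using m_inv_consistent[OF sub that] by simp
  interpret GH: group ?GH by (rule subgroup.subgroup_is_group[OF sub]) (rule is_group)
  interpret GH: left_ordered_group ?GH "P \<inter> ?H"
    using P_total by unfold_locales (auto simp: left_cone_def inv)
  have pow: "x [^]\<^bsub>?GH\<^esub> k = x [^] k" for x and k :: nat
    using nat_pow_consistent by metis
  show ?thesis
  proof
    show "inv\<^bsub>?GH\<^esub> g \<otimes>\<^bsub>?GH\<^esub> x \<otimes>\<^bsub>?GH\<^esub> g \<in> P \<inter> ?H"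
      if "x \<in> P \<inter> ?H" "g \<in> carrier ?GH" for x g
      using that bounded_subset_stabilizer cone_stabilizerD[of g x] by (auto simp: inv)
    show "m \<in> P \<inter> ?H" using m m_bounded by simp
    show "\<exists>k. GH.le x (m [^]\<^bsub>?GH\<^esub> (k::nat))" if "x \<in> carrier ?GH" for x
    proof -
      have x: "x \<in> ?H" using that by simp
      obtain k :: nat where k: "m [^] k \<otimes> inv x \<in> P" using x by (rule bounded_by_powersE)
      have "inv x \<otimes> m [^] k \<in> P" using k x m_pow_swap[of "inv x" k] by simp
      moreover have "m [^] k \<in> ?H" using m_bounded by (induction k) auto
      ultimately have "GH.le x (m [^]\<^bsub>?GH\<^esub> k)" using x by (simp add: GH.le_def inv pow)
      then show ?thesis ..
    qed
  qed
qed

end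

text \<open>
  A cone with a least element whose conjugates are all positive is never determined by finitely many of its elements,
  except in the cyclic case. The hypothesis on conjugates enters in the proof that elements
  below \<open>m\<close> stabilize the cone: it keeps \<open>e\<close> positive in the conjugated cone.
\<close>

theorem cone_subset_powers_if_finitely_determined:
  assumes F: "finite F" "F \<subseteq> P" and unique: "\<And>Q. left_cone G Q \<Longrightarrow> F \<subseteq> Q \<Longrightarrow> Q = P"
    and e: "e \<in> P" and least: "\<And>x. x \<in> P \<Longrightarrow> e \<preceq> x"
    and conj: "\<And>g. g \<in> carrier G \<Longrightarrow> g \<otimes> e \<otimes> inv g \<in> P"
  shows "P \<subseteq> range (\<lambda>k::int. e [^] k)"
proof (rule ccontr)
  let ?C = "range (\<lambda>k::int. e [^] k)"
  assume "\<not> P \<subseteq> ?C"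
  then obtain p where p: "p \<in> P - ?C" by blast
  have eG [simp]: "e \<in> carrier G" using e by simp
  have convex: "convex_subgroup ?C" by (rule convex_subgroup_least_powers[OF e least])
  \<comment> \<open>Elements of \<open>F\<close> in \<open>C\<close> are positive powers of \<open>e\<close>, so they are in every cone that contains \<open>e\<close>.\<close>
  have cone_pow: "f \<in> Q" if f: "f \<in> P \<inter> ?C" and Q: "left_cone G Q" "e \<in> Q" for f Q
  proof -
    interpret Q: left_ordered_group G Q by unfold_locales (rule Q(1))
    obtain k :: int where k: "f = e [^] k" using f by blast
    have "0 < k"
    proof (rule ccontr)
      assume "\<not> 0 < k"
      then have "inv f = e [^] nat (- k)" by (simp add: k flip: int_pow_int int_pow_neg)
      moreover have "k \<noteq> 0" using f k by auto
      ultimately have "inv f \<in> P" using P_nat_pow[OF e, of "nat (- k)"] \<open>\<not> 0 < k\<close> by simp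
      then show False using P_inv f by blast
    qed
    then have "f = e [^] nat k" by (simp add: k flip: int_pow_int)
    then show ?thesis using Q.P_nat_pow[OF Q(2), of "nat k"] \<open>0 < k\<close> by simp
  qed
  obtain m where m: "m \<in> insert p (F - ?C)" "\<forall>f\<in>insert p (F - ?C). m \<preceq> f"
  proof -
    have "finite (insert p (F - ?C))" "insert p (F - ?C) \<noteq> {}" "insert p (F - ?C) \<subseteq> carrier G"
      using F p P_subset by auto
    from least_exists[OF this] show ?thesis using that by blast
  qed
  have mP: "m \<in> P - ?C" using m(1) p F by auto
  have below: "x \<in> cone_stabilizer" if x: "x \<in> P" "x \<preceq> m" for x
  proof -
    let ?Q = "{g \<in> carrier G. inv x \<otimes> g \<otimes> x \<in> P}"
    have xG [simp]: "x \<in> carrier G" using x by simp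
    have cone: "left_cone G ?Q" by (rule left_cone_conj) simp
    have eQ: "e \<in> ?Q" using conj[of "inv x"] by simp
    have "f \<in> ?Q" if f: "f \<in> F" for f
    proof (cases "f \<in> ?C")
      case True
      then show ?thesis using cone_pow[OF _ cone eQ] f F by blast
    next
      case False
      have fP: "f \<in> P" using f F by blast
      have "x \<preceq> f" using le_trans[OF x(2)] m f False mP fP by simp
      then have "inv x \<otimes> f \<otimes> x \<in> P" using x fP by (auto simp: le_def)
      then show ?thesis using fP by simp
    qed
    then have "?Q = P" using unique[OF cone] by blast
    then show ?thesis unfolding cone_stabilizer_def by auto
  qed
  have mP': "m \<in> P" using mP by simp
  note bounded = subgroup_bounded[OF mP' below] convex_bounded[OF mP' below]
    bi_ordered_bounded[OF mP' below] m_bounded[OF mP' below]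
  define H where "H = bounded_by_powers m"
  let ?GH = "G\<lparr>carrier := H\<rparr>"
  have sub: "subgroup H G" and convH: "convex_subgroup H" and mH: "m \<in> H"
    and ordH: "bi_ordered_group_cofinal ?GH (P \<inter> H) m"
    using bounded by (auto simp: H_def)
  interpret H: subgroup H G by (rule sub)
  interpret GH: bi_ordered_group_cofinal ?GH "P \<inter> H" m by (rule ordH)
  have inv: "inv\<^bsub>?GH\<^esub> x = inv x" if "x \<in> H" for x
    using m_inv_consistent[OF sub that] by simp
  have le: "GH.le x y \<longleftrightarrow> x \<preceq> y" if "x \<in> H" "y \<in> H" for x y
    using that by (auto simp: GH.le_def le_def inv)
  have eH: "e \<in> H"
  proof -
    have "inv e \<in> ?C" by (rule range_eqI[of _ _ "-1"]) (simp add: int_pow_neg)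
    then have "m \<otimes> inv e \<in> P" by (rule convex_subgroup_mult_right[OF convex _ mP])
    moreover have "m \<otimes> e \<in> P" using mP e by blast
    ultimately have "m [^] (1::nat) \<otimes> e \<in> P \<and> m [^] (1::nat) \<otimes> inv e \<in> P" using mP by simp
    then show ?thesis unfolding H_def using bounded_by_powersI[OF eG] by blast
  qed
  have pow: "([^]\<^bsub>?GH\<^esub>) e = (\<lambda>k::int. e [^] k)"
    by (rule ext) (rule int_pow_consistent[OF sub eH, symmetric])
  have m_nC: "m \<notin> range (\<lambda>k::int. e [^]\<^bsub>?GH\<^esub> k)"
  proof -
    have "range (\<lambda>k::int. e [^]\<^bsub>?GH\<^esub> k) = ?C" by (rule arg_cong[OF pow])
    moreover have "m \<notin> ?C" using mP by simp
    ultimately show ?thesis by simp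
  qed
  interpret GH: discrete_bi_ordered_group ?GH "P \<inter> H" m e
  proof
    show "e \<in> P \<inter> H" using e eH by (rule IntI)
    show "GH.le e x" if "x \<in> P \<inter> H" for x using le[OF eH, of x] least[of x] that by simp
    show "m \<notin> range (\<lambda>k::int. e [^]\<^bsub>?GH\<^esub> k)" by (rule m_nC)
  qed
  have "finite ((F - ?C) \<inter> H)" using F by simp
  moreover have "f \<in> carrier ?GH \<and> GH.le m f" if "f \<in> (F - ?C) \<inter> H" for f
    using that m le mH by auto
  ultimately obtain R where R: "left_cone ?GH R" "e \<in> R" "(F - ?C) \<inter> H \<subseteq> R" "R \<noteq> P \<inter> H"
    using GH.perturbed_cone_exists_discrete[of "(F - ?C) \<inter> H"] by blast
  let ?Q = "(P - H) \<union> R"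
  have cone: "left_cone G ?Q" by (rule left_cone_replace_on_convex_subgroup[OF convH R(1)])
  have "f \<in> ?Q" if "f \<in> F" for f
    using cone_pow[OF _ cone, of f] R that F by blast
  then have "?Q = P" using unique[OF cone] by blast
  moreover have "R \<subseteq> H" using R(1) by (simp add: left_cone_def)
  ultimately show False using R(4) by blast
qed

end

theorem theorem4p9:
  fixes G :: "('a, 'm) monoid_scheme" (structure)
    and lt :: "'a \<Rightarrow> 'a \<Rightarrow> bool" and P :: "'a set" and \<epsilon> :: 'a
  assumes "group G"
    and "\<not> cyclic_group G"
    and "discrete_left_ordering G lt"
    and "P = positive_cone G lt"
    and "least_positive G lt \<epsilon>"
    and "\<forall>g\<in>carrier G. g \<otimes> \<epsilon> \<otimes> inv g \<in> P"
  shows "\<not> isolated_point (LO_topology G) P"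
proof
  assume isolated: "isolated_point (LO_topology G) P"
  interpret group G by fact
  have order: "left_ordering G lt" using assms(3) by (simp add: discrete_left_ordering_def)
  have "left_cone G P" unfolding assms(4) by (rule left_cone_of_ordering[OF order])
  then interpret left_ordered_group G P by unfold_locales
  obtain F where F: "finite F" "F \<subseteq> P" "\<And>Q. left_cone G Q \<Longrightarrow> F \<subseteq> Q \<Longrightarrow> Q = P"
    using isolated_point_LO_finite_witness[OF isolated] by auto
  have \<epsilon>: "\<epsilon> \<in> P" using assms(4,5) by (simp add: least_positive_def)
  have "\<epsilon> \<preceq> x" if x: "x \<in> P" for x
  proof -
    have "x = \<epsilon> \<or> lt \<epsilon> x" using assms(4,5) x by (auto simp: least_positive_def)
    moreover have "inv \<epsilon> \<otimes> x \<in> P" if less: "lt \<epsilon> x"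
    proof -
      have carrier: "inv \<epsilon> \<otimes> x \<in> carrier G" using \<epsilon> x by simp
      have "lt (inv \<epsilon> \<otimes> \<epsilon>) (inv \<epsilon> \<otimes> x)"
        using order less \<epsilon> x unfolding left_ordering_def by (meson P_carrier inv_closed)
      then have "lt \<one> (inv \<epsilon> \<otimes> x)" using \<epsilon> by simp
      then show ?thesis unfolding assms(4) positive_cone_def using carrier by blast
    qed
    ultimately show ?thesis by (auto simp: le_def)
  qed
  then have PC: "P \<subseteq> range (\<lambda>k::int. \<epsilon> [^] k)"
    using cone_subset_powers_if_finitely_determined[OF F \<epsilon>] assms(6) by blast
  have "x \<in> range (\<lambda>k::int. \<epsilon> [^] k)" if x: "x \<in> carrier G" for x
  proof -
    consider "x = \<one>" | "x \<in> P" | "inv x \<in> P" using P_total[OF x] by blast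
    then show ?thesis
    proof cases
      case 1
      then show ?thesis by (intro range_eqI[of _ _ 0]) simp
    next
      case 3
      then obtain k :: int where "inv x = \<epsilon> [^] k" using PC by blast
      then have "x = \<epsilon> [^] (- k)" using x \<epsilon> by (metis int_pow_neg inv_inv P_carrier)
      then show ?thesis by blast
    qed (use PC in blast)
  qed
  then have "carrier G = range (\<lambda>k::int. \<epsilon> [^] k)" using \<epsilon> by auto
  then have "cyclic_group G" using cyclic_group \<epsilon> P_carrier by blast
  then show False using assms(2) by simp
qed

end
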